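(* Let $\mathcal E$ and $\mathcal E'$ be essentially small idempotent-complete exact categories with enough projective objects, let $F:\mathcal E\to\mathcal E'$ be an exact functor, and suppose $c=\operatorname{pd}(F)<\infty$. Then, for every $X\in\mathcal E$ and every $k\ge1$, $$k\text{-}\operatorname{dell}_{\mathcal E'}F(X)\le c+k\text{-}\operatorname{dell}_{\mathcal E}X,$$ $$k\text{-}\operatorname{ddell}_{\mathcal E'}F(X)\le c+k\text{-}\operatorname{ddell}_{\mathcal E}X .$$
   Context: For an exact functor $F$ as in the claim, $\operatorname{pd}(F)=\sup\{\operatorname{pd}_{\mathcal E'}F(P)\mid P\in\operatorname{Proj}\mathcal E\}$, where $\operatorname{pd}_{\mathcal E'}M$ is the least $d\ge0$ such that a $d$-th syzygy of $M$ is projective ($\infty$ if none exists). For an exact category $\mathcal E$ with enough projectives: short exact sequences of the exact structure are called conflations. For each $X\in\mathcal E$ fix a conflation $0\to\Omega_{\mathcal E}X\to P_X\to X\to0$ with $P_X$ projective. The stable category $\underline{\mathcal E}=\mathcal E/[\operatorname{Proj}\mathcal E]$ has morphisms modulo those factoring through projectives, and $\Omega_{\mathcal E}$ is an endofunctor of it. $X$ is a stable retract of $Y$ if there are $u:X\to Y$, $v:Y\to X$ in $\underline{\mathcal E}$ with $vu=1_X$. For $k\ge1$, $$k\text{-}\operatorname{dell}_{\mathcal E}X=\inf\{n\ge0\mid \Omega_{\mathcal E}^nX\text{ is a stable retract of }\Omega_{\mathcal E}^{n+k}Y\text{ for some }Y\in\mathcal E\}.$$ A sequence $0\to C_t\to\cdots\to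 C_0\to X\to0$ is admissibly exact if there are objects $Z_0=X,Z_1,\dots,Z_t=C_t$ and conflations $0\to Z_{i+1}\to C_i\to Z_i\to0$ for $0\le i<t$ from which it is spliced (for $t=0$: $C_0\to X$ is an isomorphism). $k\text{-}\operatorname{ddell}_{\mathcal E}X$ is the infimum of the integers $m\ge0$ such that there are $0\le t\le m$ and an admissibly exact sequence $0\to C_t\to\cdots\to C_0\to X\to0$ with $(i+k)\text{-}\operatorname{dell}_{\mathcal E}C_i\le m-i$ for $0\le i\le t$. ($\inf\emptyset=\infty$.) *)

theory Defs
  imports "HOL-Algebra.Group" "HOL-Library.Extended_Nat"
begin

section \<open>Categories\<close>

text \<open>
  Objects and morphisms are sets in arbitrary types, so every category in this sense has only
  a set of objects; essential smallness needs no separate hypothesis.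
  \<open>Comp C g f\<close> is \<open>g \<circ> f\<close> and is meaningful only when \<open>Cod C f = Dom C g\<close>.
\<close>

record ('o, 'm) cat =
  Ob :: "'o set"
  Ar :: "'m set"
  Dom :: "'m \<Rightarrow> 'o"
  Cod :: "'m \<Rightarrow> 'o"
  Id :: "'o \<Rightarrow> 'm"
  Comp :: "'m \<Rightarrow> 'm \<Rightarrow> 'm"

definition Hom :: "('o, 'm, 'z) cat_scheme \<Rightarrow> 'o \<Rightarrow> 'o \<Rightarrow> 'm set" where
  "Hom C X Y = {f \<in> Ar C. Dom C f = X \<and> Cod C f = Y}"

locale category =
  fixes C :: "('o, 'm, 'z) cat_scheme"
  assumes Dom_in: "f \<in> Ar C \<Longrightarrow> Dom C f \<in> Ob C"
    and Cod_in: "f \<in> Ar C \<Longrightarrow> Cod C f \<in> Ob C"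
    and Id_in: "X \<in> Ob C \<Longrightarrow> Id C X \<in> Hom C X X"
    and Comp_in: "f \<in> Hom C X Y \<Longrightarrow> g \<in> Hom C Y Z \<Longrightarrow> Comp C g f \<in> Hom C X Z"
    and Comp_assoc: "f \<in> Hom C X Y \<Longrightarrow> g \<in> Hom C Y Z \<Longrightarrow> h \<in> Hom C Z W \<Longrightarrow>
      Comp C h (Comp C g f) = Comp C (Comp C h g) f"
    and Id_left: "f \<in> Hom C X Y \<Longrightarrow> Comp C (Id C Y) f = f"
    and Id_right: "f \<in> Hom C X Y \<Longrightarrow> Comp C f (Id C X) = f"

definition is_iso :: "('o, 'm, 'z) cat_scheme \<Rightarrow> 'o \<Rightarrow> 'o \<Rightarrow> 'm \<Rightarrow> bool" where
  "is_iso C X Y f \<longleftrightarrow> f \<in> Hom C X Y \<and>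
     (\<exists>g \<in> Hom C Y X. Comp C g f = Id C X \<and> Comp C f g = Id C Y)"

definition is_retract :: "('o, 'm, 'z) cat_scheme \<Rightarrow> 'o \<Rightarrow> 'o \<Rightarrow> bool" where
  "is_retract C X Y \<longleftrightarrow> (\<exists>u \<in> Hom C X Y. \<exists>v \<in> Hom C Y X. Comp C v u = Id C X)"

definition idempotent_complete :: "('o, 'm, 'z) cat_scheme \<Rightarrow> bool" where
  "idempotent_complete C \<longleftrightarrow>
     (\<forall>X \<in> Ob C. \<forall>e \<in> Hom C X X. Comp C e e = e \<longrightarrow>
        (\<exists>Y \<in> Ob C. \<exists>r \<in> Hom C X Y. \<exists>s \<in> Hom C Y X.
           Comp C s r = e \<and> Comp C r s = Id C Y))"

definition zero_object :: "('o, 'm, 'z) cat_scheme \<Rightarrow> 'o \<Rightarrow> bool" where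
  "zero_object C Z \<longleftrightarrow> Z \<in> Ob C \<and>
     (\<forall>X \<in> Ob C. (\<exists>!f. f \<in> Hom C Z X) \<and> (\<exists>!f. f \<in> Hom C X Z))"

text \<open>
  The square with top \<open>i : A \<rightarrow> B\<close>, left \<open>f : A \<rightarrow> A'\<close>, bottom \<open>i' : A' \<rightarrow> B'\<close> and
  right \<open>f' : B \<rightarrow> B'\<close>.
\<close>

definition is_pushout :: "('o, 'm, 'z) cat_scheme \<Rightarrow> 'm \<Rightarrow> 'm \<Rightarrow> 'm \<Rightarrow> 'm \<Rightarrow> bool" where
  "is_pushout C i f i' f' \<longleftrightarrow>
     (\<exists>A B A' B'. i \<in> Hom C A B \<and> f \<in> Hom C A A' \<and> i' \<in> Hom C A' B' \<and> f' \<in> Hom C B B' \<and>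
        Comp C f' i = Comp C i' f \<and>
        (\<forall>T \<in> Ob C. \<forall>g \<in> Hom C B T. \<forall>h \<in> Hom C A' T. Comp C g i = Comp C h f \<longrightarrow>
           (\<exists>!w. w \<in> Hom C B' T \<and> Comp C w f' = g \<and> Comp C w i' = h)))"

text \<open>
  The square with top \<open>p' : B' \<rightarrow> A'\<close>, left \<open>f' : B' \<rightarrow> B\<close>, bottom \<open>p : B \<rightarrow> A\<close> and
  right \<open>f : A' \<rightarrow> A\<close>.
\<close>

definition is_pullback :: "('o, 'm, 'z) cat_scheme \<Rightarrow> 'm \<Rightarrow> 'm \<Rightarrow> 'm \<Rightarrow> 'm \<Rightarrow> bool" where
  "is_pullback C p f p' f' \<longleftrightarrow>
     (\<exists>A B A' B'. p \<in> Hom C B A \<and> f \<in> Hom C A' A \<and> p' \<in> Hom C B' A' \<and> f' \<in> Hom C B' B \<and>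
        Comp C p f' = Comp C f p' \<and>
        (\<forall>T \<in> Ob C. \<forall>g \<in> Hom C T B. \<forall>h \<in> Hom C T A'. Comp C p g = Comp C f h \<longrightarrow>
           (\<exists>!w. w \<in> Hom C T B' \<and> Comp C f' w = g \<and> Comp C p' w = h)))"


section \<open>Additive categories\<close>

record ('o, 'm) add_cat = "('o, 'm) cat" +
  Add :: "'m \<Rightarrow> 'm \<Rightarrow> 'm"
  Zer :: "'o \<Rightarrow> 'o \<Rightarrow> 'm"

definition Hom_group :: "('o, 'm, 'z) add_cat_scheme \<Rightarrow> 'o \<Rightarrow> 'o \<Rightarrow> 'm monoid" where
  "Hom_group C X Y = \<lparr>carrier = Hom C X Y, mult = Add C, one = Zer C X Y\<rparr>"

definition is_biproduct ::
  "('o, 'm, 'z) add_cat_scheme \<Rightarrow> 'o \<Rightarrow> 'o \<Rightarrow> 'o \<Rightarrow> 'm \<Rightarrow> 'm \<Rightarrow> 'm \<Rightarrow> 'm \<Rightarrow> bool" where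
  "is_biproduct C X Y B i1 i2 p1 p2 \<longleftrightarrow>
     i1 \<in> Hom C X B \<and> i2 \<in> Hom C Y B \<and> p1 \<in> Hom C B X \<and> p2 \<in> Hom C B Y \<and>
     Comp C p1 i1 = Id C X \<and> Comp C p2 i2 = Id C Y \<and>
     Comp C p1 i2 = Zer C Y X \<and> Comp C p2 i1 = Zer C X Y \<and>
     Add C (Comp C i1 p1) (Comp C i2 p2) = Id C B"

locale additive_category = category C
  for C :: "('o, 'm, 'z) add_cat_scheme" +
  assumes Hom_comm_group: "X \<in> Ob C \<Longrightarrow> Y \<in> Ob C \<Longrightarrow> comm_group (Hom_group C X Y)"
    and Comp_Add_left: "f \<in> Hom C X Y \<Longrightarrow> g \<in> Hom C Y Z \<Longrightarrow> h \<in> Hom C Y Z \<Longrightarrow>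
      Comp C (Add C g h) f = Add C (Comp C g f) (Comp C h f)"
    and Comp_Add_right: "f \<in> Hom C X Y \<Longrightarrow> g \<in> Hom C X Y \<Longrightarrow> h \<in> Hom C Y Z \<Longrightarrow>
      Comp C h (Add C f g) = Add C (Comp C h f) (Comp C h g)"
    and zero_object_ex: "\<exists>Z. zero_object C Z"
    and biproduct_ex: "X \<in> Ob C \<Longrightarrow> Y \<in> Ob C \<Longrightarrow>
      \<exists>B \<in> Ob C. \<exists>i1 i2 p1 p2. is_biproduct C X Y B i1 i2 p1 p2"

definition is_kernel :: "('o, 'm, 'z) add_cat_scheme \<Rightarrow> 'm \<Rightarrow> 'm \<Rightarrow> bool" where
  "is_kernel C i p \<longleftrightarrow>
     (\<exists>X Y Z. i \<in> Hom C X Y \<and> p \<in> Hom C Y Z \<and> Comp C p i = Zer C X Z \<and>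
        (\<forall>T \<in> Ob C. \<forall>f \<in> Hom C T Y. Comp C p f = Zer C T Z \<longrightarrow>
           (\<exists>!g. g \<in> Hom C T X \<and> Comp C i g = f)))"

definition is_cokernel :: "('o, 'm, 'z) add_cat_scheme \<Rightarrow> 'm \<Rightarrow> 'm \<Rightarrow> bool" where
  "is_cokernel C p i \<longleftrightarrow>
     (\<exists>X Y Z. i \<in> Hom C X Y \<and> p \<in> Hom C Y Z \<and> Comp C p i = Zer C X Z \<and>
        (\<forall>T \<in> Ob C. \<forall>f \<in> Hom C Y T. Comp C f i = Zer C X T \<longrightarrow>
           (\<exists>!g. g \<in> Hom C Z T \<and> Comp C g p = f)))"


section \<open>Exact categories\<close>

text \<open>
  \<open>Conf\<close> is the class of conflations, as pairs \<open>(i, p)\<close> with \<open>0 \<rightarrow> X \<rightarrow> Y \<rightarrow> Z \<rightarrow> 0\<close> given by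
  \<open>i : X \<rightarrow> Y\<close> and \<open>p : Y \<rightarrow> Z\<close>.
\<close>

record ('o, 'm) exact_cat = "('o, 'm) add_cat" +
  Conf :: "('m \<times> 'm) set"

definition conflation ::
  "('o, 'm, 'z) exact_cat_scheme \<Rightarrow> 'o \<Rightarrow> 'm \<Rightarrow> 'o \<Rightarrow> 'm \<Rightarrow> 'o \<Rightarrow> bool" where
  "conflation E X i Y p Z \<longleftrightarrow> i \<in> Hom E X Y \<and> p \<in> Hom E Y Z \<and> (i, p) \<in> Conf E"

definition inflation :: "('o, 'm, 'z) exact_cat_scheme \<Rightarrow> 'm \<Rightarrow> bool" where
  "inflation E i \<longleftrightarrow> (\<exists>p. (i, p) \<in> Conf E)"

definition deflation :: "('o, 'm, 'z) exact_cat_scheme \<Rightarrow> 'm \<Rightarrow> bool" where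
  "deflation E p \<longleftrightarrow> (\<exists>i. (i, p) \<in> Conf E)"

text \<open>Quillen's axioms, in the form given by Buehler.\<close>

locale exact_category = additive_category E
  for E :: "('o, 'm, 'z) exact_cat_scheme" +
  assumes Conf_kernel: "(i, p) \<in> Conf E \<Longrightarrow> is_kernel E i p"
    and Conf_cokernel: "(i, p) \<in> Conf E \<Longrightarrow> is_cokernel E p i"
    and Conf_iso: "conflation E X i Y p Z \<Longrightarrow> i' \<in> Hom E X' Y' \<Longrightarrow> p' \<in> Hom E Y' Z' \<Longrightarrow>
      is_iso E X X' a \<Longrightarrow> is_iso E Y Y' b \<Longrightarrow> is_iso E Z Z' c \<Longrightarrow>
      Comp E b i = Comp E i' a \<Longrightarrow> Comp E c p = Comp E p' b \<Longrightarrow> (i', p') \<in> Conf E"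
    and inflation_Id: "X \<in> Ob E \<Longrightarrow> inflation E (Id E X)"
    and deflation_Id: "X \<in> Ob E \<Longrightarrow> deflation E (Id E X)"
    and inflation_Comp: "i \<in> Hom E X Y \<Longrightarrow> j \<in> Hom E Y Z \<Longrightarrow>
      inflation E i \<Longrightarrow> inflation E j \<Longrightarrow> inflation E (Comp E j i)"
    and deflation_Comp: "p \<in> Hom E X Y \<Longrightarrow> q \<in> Hom E Y Z \<Longrightarrow>
      deflation E p \<Longrightarrow> deflation E q \<Longrightarrow> deflation E (Comp E q p)"
    and inflation_pushout: "i \<in> Hom E A B \<Longrightarrow> inflation E i \<Longrightarrow> f \<in> Hom E A A' \<Longrightarrow>
      \<exists>i' f'. is_pushout E i f i' f' \<and> inflation E i'"
    and deflation_pullback: "p \<in> Hom E B A \<Longrightarrow> deflation E p \<Longrightarrow> f \<in> Hom E A' A \<Longrightarrow>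
      \<exists>p' f'. is_pullback E p f p' f' \<and> deflation E p'"

definition Proj :: "('o, 'm, 'z) exact_cat_scheme \<Rightarrow> 'o set" where
  "Proj E = {P \<in> Ob E. \<forall>Y Z. \<forall>p \<in> Hom E Y Z. \<forall>f \<in> Hom E P Z. deflation E p \<longrightarrow>
     (\<exists>g \<in> Hom E P Y. Comp E p g = f)}"

definition enough_projectives :: "('o, 'm, 'z) exact_cat_scheme \<Rightarrow> bool" where
  "enough_projectives E \<longleftrightarrow>
     (\<forall>X \<in> Ob E. \<exists>K P i p. P \<in> Proj E \<and> conflation E K i P p X)"


section \<open>Projective dimension\<close>

text \<open>\<open>is_syzygy E d M N\<close>: \<open>N\<close> is some \<open>d\<close>-th syzygy of \<open>M\<close>, for arbitrary choices of a
  deflation from a projective at each step.\<close>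

inductive is_syzygy :: "('o, 'm, 'z) exact_cat_scheme \<Rightarrow> nat \<Rightarrow> 'o \<Rightarrow> 'o \<Rightarrow> bool"
  for E :: "('o, 'm, 'z) exact_cat_scheme" where
  zero: "M \<in> Ob E \<Longrightarrow> is_syzygy E 0 M M"
| step: "P \<in> Proj E \<Longrightarrow> conflation E K i P p M \<Longrightarrow> is_syzygy E d K N \<Longrightarrow>
    is_syzygy E (Suc d) M N"

definition pd :: "('o, 'm, 'z) exact_cat_scheme \<Rightarrow> 'o \<Rightarrow> enat" where
  "pd E M = Inf {enat d | d. \<exists>N \<in> Proj E. is_syzygy E d M N}"


section \<open>Exact functors\<close>

record ('o, 'm, 'p, 'n) ftor =
  FOb :: "'o \<Rightarrow> 'p"
  FAr :: "'m \<Rightarrow> 'n"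

locale exact_functor =
  fixes E :: "('o, 'm, 'z) exact_cat_scheme"
    and E' :: "('p, 'n, 'w) exact_cat_scheme"
    and F :: "('o, 'm, 'p, 'n, 'u) ftor_scheme"
  assumes FOb_in: "X \<in> Ob E \<Longrightarrow> FOb F X \<in> Ob E'"
    and FAr_in: "f \<in> Hom E X Y \<Longrightarrow> FAr F f \<in> Hom E' (FOb F X) (FOb F Y)"
    and FAr_Id: "X \<in> Ob E \<Longrightarrow> FAr F (Id E X) = Id E' (FOb F X)"
    and FAr_Comp: "f \<in> Hom E X Y \<Longrightarrow> g \<in> Hom E Y Z \<Longrightarrow>
      FAr F (Comp E g f) = Comp E' (FAr F g) (FAr F f)"
    and FAr_Add: "f \<in> Hom E X Y \<Longrightarrow> g \<in> Hom E X Y \<Longrightarrow>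
      FAr F (Add E f g) = Add E' (FAr F f) (FAr F g)"
    and FAr_Conf: "(i, p) \<in> Conf E \<Longrightarrow> (FAr F i, FAr F p) \<in> Conf E'"

definition pd_functor ::
  "('o, 'm, 'z) exact_cat_scheme \<Rightarrow> ('p, 'n, 'w) exact_cat_scheme \<Rightarrow>
   ('o, 'm, 'p, 'n, 'u) ftor_scheme \<Rightarrow> enat" where
  "pd_functor E E' F = Sup {pd E' (FOb F P) | P. P \<in> Proj E}"


section \<open>The stable category\<close>

definition factors_through_proj :: "('o, 'm, 'z) exact_cat_scheme \<Rightarrow> 'm \<Rightarrow> bool" where
  "factors_through_proj E f \<longleftrightarrow>
     (\<exists>X Y. \<exists>P \<in> Proj E. \<exists>a \<in> Hom E X P. \<exists>b \<in> Hom E P Y. f = Comp E b a)"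

text \<open>Congruence modulo the ideal of morphisms factoring through projectives.\<close>

definition stable_rel :: "('o, 'm, 'z) exact_cat_scheme \<Rightarrow> ('m \<times> 'm) set" where
  "stable_rel E = {(f, g). \<exists>X Y. f \<in> Hom E X Y \<and> g \<in> Hom E X Y \<and>
     (\<exists>h \<in> Hom E X Y. factors_through_proj E h \<and> f = Add E g h)}"

definition stable_category :: "('o, 'm, 'z) exact_cat_scheme \<Rightarrow> ('o, 'm set) cat" where
  "stable_category E =
     \<lparr>Ob = Ob E,
      Ar = Ar E // stable_rel E,
      Dom = (\<lambda>\<phi>. THE X. \<exists>f \<in> \<phi>. Dom E f = X),
      Cod = (\<lambda>\<phi>. THE Y. \<exists>f \<in> \<phi>. Cod E f = Y),
      Id = (\<lambda>X. stable_rel E `` {Id E X}),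
      Comp = (\<lambda>\<psi> \<phi>. \<Union>g \<in> \<psi>. \<Union>f \<in> \<phi>. stable_rel E `` {Comp E g f})\<rparr>"

definition stable_retract :: "('o, 'm, 'z) exact_cat_scheme \<Rightarrow> 'o \<Rightarrow> 'o \<Rightarrow> bool" where
  "stable_retract E X Y \<longleftrightarrow> is_retract (stable_category E) X Y"


section \<open>Delooping levels\<close>

text \<open>
  A choice \<open>S\<close> of a conflation \<open>S X = (i, p)\<close> from a projective onto each \<open>X\<close>, which fixes
  the syzygy \<open>\<Omega> X\<close>. Only the action of \<open>\<Omega>\<close> on objects enters below.
\<close>

definition syzygy_choice :: "('o, 'm, 'z) exact_cat_scheme \<Rightarrow> ('o \<Rightarrow> 'm \<times> 'm) \<Rightarrow> bool" where
  "syzygy_choice E S \<longleftrightarrow>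
     (\<forall>X \<in> Ob E. \<exists>K. \<exists>P \<in> Proj E. conflation E K (fst (S X)) P (snd (S X)) X)"

definition Omega :: "('o, 'm, 'z) exact_cat_scheme \<Rightarrow> ('o \<Rightarrow> 'm \<times> 'm) \<Rightarrow> 'o \<Rightarrow> 'o" where
  "Omega E S X = Dom E (fst (S X))"

definition dell ::
  "('o, 'm, 'z) exact_cat_scheme \<Rightarrow> ('o \<Rightarrow> 'm \<times> 'm) \<Rightarrow> nat \<Rightarrow> 'o \<Rightarrow> enat" where
  "dell E S k X =
     Inf {enat n | n. \<exists>Y \<in> Ob E. stable_retract E ((Omega E S ^^ n) X) ((Omega E S ^^ (n + k)) Y)}"

text \<open>
  \<open>adm_exact E t C d X\<close>: the sequence \<open>0 \<rightarrow> C t \<rightarrow> \<dots> \<rightarrow> C 0 \<rightarrow> X \<rightarrow> 0\<close> with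
  \<open>d 0 : C 0 \<rightarrow> X\<close> and \<open>d i : C i \<rightarrow> C (i - 1)\<close> for \<open>0 < i \<le> t\<close> is spliced from conflations
  \<open>0 \<rightarrow> Z (i + 1) \<rightarrow> C i \<rightarrow> Z i \<rightarrow> 0\<close> given by \<open>a i\<close> and \<open>b i\<close>. The values of \<open>C\<close> and \<open>d\<close>
  beyond \<open>t\<close> are irrelevant.
\<close>

definition adm_exact ::
  "('o, 'm, 'z) exact_cat_scheme \<Rightarrow> nat \<Rightarrow> (nat \<Rightarrow> 'o) \<Rightarrow> (nat \<Rightarrow> 'm) \<Rightarrow> 'o \<Rightarrow> bool" where
  "adm_exact E t C d X \<longleftrightarrow>
     (if t = 0 then is_iso E (C 0) X (d 0)
      else \<exists>Z a b. Z 0 = X \<and> Z t = C t \<and>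
        (\<forall>i < t. conflation E (Z (Suc i)) (a i) (C i) (b i) (Z i)) \<and>
        d 0 = b 0 \<and>
        (\<forall>i. 0 < i \<and> i < t \<longrightarrow> d i = Comp E (a (i - 1)) (b i)) \<and>
        d t = a (t - 1))"

definition ddell ::
  "('o, 'm, 'z) exact_cat_scheme \<Rightarrow> ('o \<Rightarrow> 'm \<times> 'm) \<Rightarrow> nat \<Rightarrow> 'o \<Rightarrow> enat" where
  "ddell E S k X =
     Inf {enat m | m. \<exists>t \<le> m. \<exists>C d. adm_exact E t C d X \<and>
       (\<forall>i \<le> t. dell E S (i + k) (C i) \<le> enat (m - i))}"

end

theory Submission
  imports Defs
begin

text \<open>
  If \<open>0 \<rightarrow> A \<rightarrow> Q \<rightarrow> B \<rightarrow> 0\<close> is a conflation and \<open>Q\<close> has projective dimension at most \<open>c\<close>, then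
  \<open>\<Omega>\<^sup>c A\<close> and \<open>\<Omega>\<^sup>c\<^sup>+\<^sup>1 B\<close> agree stably. Applied to the images under \<open>F\<close> of the syzygy conflations
  of \<open>X\<close>, with \<open>c = pd F\<close>, this makes \<open>\<Omega>\<^sup>c F (\<Omega>\<^sup>n X)\<close> and \<open>\<Omega>\<^sup>c\<^sup>+\<^sup>n F X\<close> agree stably. Moreover
  \<open>\<Omega>\<^sup>c F\<close> preserves stable retracts, because it sends projectives to projectives. So if
  \<open>\<Omega>\<^sup>n X\<close> is a stable retract of \<open>\<Omega>\<^sup>n\<^sup>+\<^sup>k Y\<close>, then \<open>\<Omega>\<^sup>c\<^sup>+\<^sup>n F X\<close> is one of
  \<open>\<Omega>\<^sup>c\<^sup>+\<^sup>n\<^sup>+\<^sup>k F Y\<close>. The bound for \<open>ddell\<close> follows by applying \<open>F\<close> to an optimal admissibly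
  exact sequence and using the first bound for each term.

  Instead of stable isomorphism, only the relation of being stable retracts of each other is
  used: it is preserved by syzygies and needs no functoriality of \<open>\<Omega>\<close>.
\<close>

section \<open>Calculus of arrows\<close>

lemma HomD: "f \<in> Hom C X Y \<Longrightarrow> f \<in> Ar C \<and> Dom C f = X \<and> Cod C f = Y"
  by (simp add: Hom_def)

text \<open>
  The rules below are stated with \<open>Ar\<close>, \<open>Dom\<close> and \<open>Cod\<close> instead of \<open>Hom\<close>, so that no premise
  contains an object absent from the conclusion and the simplifier can discharge them.
\<close>

context category
begin

lemma arr_Comp:
  assumes "f \<in> Ar C" "g \<in> Ar C" "Dom C g = Cod C f"
  shows "Comp C g f \<in> Ar C" "Dom C (Comp C g f) = Dom C f" "Cod C (Comp C g f) = Cod C g"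
  using Comp_in[of f "Dom C f" "Cod C f" g "Cod C g"] assms by (auto simp: Hom_def)

lemma arr_Id:
  assumes "X \<in> Ob C"
  shows "Id C X \<in> Ar C" "Dom C (Id C X) = X" "Cod C (Id C X) = X"
  using Id_in[OF assms] by (auto simp: Hom_def)

lemma arr_assoc:
  assumes "f \<in> Ar C" "g \<in> Ar C" "h \<in> Ar C" "Dom C g = Cod C f" "Dom C h = Cod C g"
  shows "Comp C (Comp C h g) f = Comp C h (Comp C g f)"
  using Comp_assoc[of f "Dom C f" "Cod C f" g "Cod C g" h "Cod C h"] assms by (auto simp: Hom_def)

lemma arr_Id_left: "f \<in> Ar C \<Longrightarrow> Cod C f = Y \<Longrightarrow> Comp C (Id C Y) f = f"
  using Id_left[of f "Dom C f" "Cod C f"] by (auto simp: Hom_def)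

lemma arr_Id_right: "f \<in> Ar C \<Longrightarrow> Dom C f = X \<Longrightarrow> Comp C f (Id C X) = f"
  using Id_right[of f "Dom C f" "Cod C f"] by (auto simp: Hom_def)

end

section \<open>Additive arithmetic of parallel morphisms\<close>

context additive_category
begin

lemma arr_Add:
  assumes "f \<in> Ar C" "g \<in> Ar C" "Dom C g = Dom C f" "Cod C g = Cod C f"
  shows "Add C f g \<in> Ar C" "Dom C (Add C f g) = Dom C f" "Cod C (Add C f g) = Cod C f"
proof -
  interpret H: comm_group "Hom_group C (Dom C f) (Cod C f)"
    using assms by (intro Hom_comm_group Dom_in Cod_in)
  have "Add C f g \<in> Hom C (Dom C f) (Cod C f)"
    using H.m_closed[of f g] assms by (simp add: Hom_group_def Hom_def)
  then show "Add C f g \<in> Ar C" "Dom C (Add C f g) = Dom C f" "Cod C (Add C f g) = Cod C f"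
    by (auto simp: Hom_def)
qed

lemma arr_Zer:
  assumes "X \<in> Ob C" "Y \<in> Ob C"
  shows "Zer C X Y \<in> Ar C" "Dom C (Zer C X Y) = X" "Cod C (Zer C X Y) = Y"
proof -
  interpret H: comm_group "Hom_group C X Y"
    using assms by (rule Hom_comm_group)
  show "Zer C X Y \<in> Ar C" "Dom C (Zer C X Y) = X" "Cod C (Zer C X Y) = Y"
    using H.one_closed by (auto simp: Hom_group_def Hom_def)
qed

lemma Add_commute:
  assumes "f \<in> Ar C" "g \<in> Ar C" "Dom C g = Dom C f" "Cod C g = Cod C f"
  shows "Add C f g = Add C g f"
proof -
  interpret H: comm_group "Hom_group C (Dom C f) (Cod C f)"
    using assms by (intro Hom_comm_group Dom_in Cod_in)
  show ?thesis using H.m_comm[of f g] assms by (simp add: Hom_group_def Hom_def)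
qed

lemma Add_assoc:
  assumes "f \<in> Ar C" "g \<in> Ar C" "h \<in> Ar C"
    "Dom C g = Dom C f" "Cod C g = Cod C f" "Dom C h = Dom C f" "Cod C h = Cod C f"
  shows "Add C (Add C f g) h = Add C f (Add C g h)"
proof -
  interpret H: comm_group "Hom_group C (Dom C f) (Cod C f)"
    using assms by (intro Hom_comm_group Dom_in Cod_in)
  show ?thesis using H.m_assoc[of f g h] assms by (simp add: Hom_group_def Hom_def)
qed

lemma Add_eq_self:
  assumes "f \<in> Ar C" "g \<in> Ar C" "Dom C g = Dom C f" "Cod C g = Cod C f" "Add C f g = f"
  shows "g = Zer C (Dom C f) (Cod C f)"
proof -
  interpret H: comm_group "Hom_group C (Dom C f) (Cod C f)"
    using assms by (intro Hom_comm_group Dom_in Cod_in)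
  show ?thesis using H.r_cancel_one'[of f g] H.m_comm[of f g] assms
    by (simp add: Hom_group_def Hom_def)
qed

lemma Zer_Add:
  assumes "f \<in> Ar C" "Dom C f = X" "Cod C f = Y"
  shows "Add C (Zer C X Y) f = f"
proof -
  interpret H: comm_group "Hom_group C (Dom C f) (Cod C f)"
    using assms by (intro Hom_comm_group Dom_in Cod_in)
  show ?thesis using H.l_one[of f] assms by (simp add: Hom_group_def Hom_def)
qed

lemma Add_Zer:
  assumes "f \<in> Ar C" "Dom C f = X" "Cod C f = Y"
  shows "Add C f (Zer C X Y) = f"
  using Zer_Add[OF assms] Add_commute[of f "Zer C X Y"] arr_Zer[of X Y] assms
    Dom_in Cod_in by metis

text \<open>The structure carries no negation. This difference, built from the inverse in the Hom
  group, is how morphisms are subtracted below.\<close>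

lemma difference_ex:
  assumes "f \<in> Ar C" "g \<in> Ar C" "Dom C g = Dom C f" "Cod C g = Cod C f"
  obtains d where "d \<in> Ar C" "Dom C d = Dom C f" "Cod C d = Cod C f" "Add C g d = f"
proof -
  interpret H: comm_group "Hom_group C (Dom C f) (Cod C f)"
    using assms by (intro Hom_comm_group Dom_in Cod_in)
  let ?G = "Hom_group C (Dom C f) (Cod C f)"
  have fg: "f \<in> carrier ?G" "g \<in> carrier ?G"
    using assms by (auto simp: Hom_group_def Hom_def)
  have "inv\<^bsub>?G\<^esub> g \<otimes>\<^bsub>?G\<^esub> f \<in> carrier ?G"
    using fg by simp
  moreover have "g \<otimes>\<^bsub>?G\<^esub> (inv\<^bsub>?G\<^esub> g \<otimes>\<^bsub>?G\<^esub> f) = f"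
    using fg by (simp add: H.m_assoc[symmetric])
  ultimately show ?thesis
    using that[of "inv\<^bsub>?G\<^esub> g \<otimes>\<^bsub>?G\<^esub> f"] by (simp add: Hom_group_def Hom_def)
qed

lemma Comp_Add_distrib:
  assumes "f \<in> Ar C" "g \<in> Ar C" "Dom C g = Dom C f" "Cod C g = Cod C f"
    "h \<in> Ar C"
  shows "Dom C h = Cod C f \<Longrightarrow> Comp C h (Add C f g) = Add C (Comp C h f) (Comp C h g)"
    and "Cod C h = Dom C f \<Longrightarrow> Comp C (Add C f g) h = Add C (Comp C f h) (Comp C g h)"
  using Comp_Add_right[of f "Dom C f" "Cod C f" g h "Cod C h"]
    Comp_Add_left[of h "Dom C h" "Dom C f" f "Cod C f" g] assms
  by (auto simp: Hom_def)

text \<open>Additivity makes the composite \<open>z\<close> satisfy \<open>z + z = z\<close>, and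
  cancellation in the Hom group gives zero.\<close>

lemma Comp_Zer:
  assumes f: "f \<in> Ar C" "Dom C f = Y" "Cod C f = Z" and X: "X \<in> Ob C"
  shows "Comp C f (Zer C X Y) = Zer C X Z"
proof -
  have Y: "Y \<in> Ob C" "Z \<in> Ob C" using f Dom_in Cod_in by auto
  note arr = arr_Zer[OF X Y(1)] arr_Zer[OF X Y(2)]
  have "Add C (Comp C f (Zer C X Y)) (Comp C f (Zer C X Y)) = Comp C f (Add C (Zer C X Y) (Zer C X Y))"
    using Comp_Add_distrib f arr by simp
  also have "\<dots> = Comp C f (Zer C X Y)"
    using arr by (simp add: Zer_Add)
  finally show ?thesis
    using Add_eq_self[of "Comp C f (Zer C X Y)" "Comp C f (Zer C X Y)"] f arr by (simp add: arr_Comp)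
qed

lemma Zer_Comp:
  assumes f: "f \<in> Ar C" "Dom C f = X" "Cod C f = Y" and Z: "Z \<in> Ob C"
  shows "Comp C (Zer C Y Z) f = Zer C X Z"
proof -
  have Y: "Y \<in> Ob C" "X \<in> Ob C" using f Dom_in Cod_in by auto
  note arr = arr_Zer[OF Y(1) Z] arr_Zer[OF Y(2) Z]
  have "Add C (Comp C (Zer C Y Z) f) (Comp C (Zer C Y Z) f) = Comp C (Add C (Zer C Y Z) (Zer C Y Z)) f"
    using Comp_Add_distrib f arr by simp
  also have "\<dots> = Comp C (Zer C Y Z) f"
    using arr by (simp add: Zer_Add)
  finally show ?thesis
    using Add_eq_self[of "Comp C (Zer C Y Z) f" "Comp C (Zer C Y Z) f"] f arr by (simp add: arr_Comp)
qed

text \<open>The normal form nests composites and sums to the right, distributes composition over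
  sums and removes zeros.\<close>

lemmas arr_simps = Dom_in Cod_in arr_Comp arr_Id arr_Add arr_Zer arr_assoc arr_Id_left arr_Id_right
  Add_assoc Zer_Add Add_Zer Comp_Zer Zer_Comp Comp_Add_distrib

end

section \<open>Kernels of deflations and lifts from projectives\<close>

context exact_category
begin

lemma conflationD:
  assumes "conflation E X i Y p Z"
  shows "i \<in> Ar E" "Dom E i = X" "Cod E i = Y" "p \<in> Ar E" "Dom E p = Y" "Cod E p = Z"
    "X \<in> Ob E" "Y \<in> Ob E" "Z \<in> Ob E" "Comp E p i = Zer E X Z" "deflation E p"
proof -
  show *: "i \<in> Ar E" "Dom E i = X" "Cod E i = Y" "p \<in> Ar E" "Dom E p = Y" "Cod E p = Z"
    using assms by (auto simp: conflation_def Hom_def)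
  then show "X \<in> Ob E" "Y \<in> Ob E" "Z \<in> Ob E" by (auto simp: Dom_in Cod_in)
  have "(i, p) \<in> Conf E" using assms by (simp add: conflation_def)
  from Conf_kernel[OF this] show "Comp E p i = Zer E X Z"
    using * by (auto simp: is_kernel_def Hom_def)
  show "deflation E p" using \<open>(i, p) \<in> Conf E\<close> by (auto simp: deflation_def)
qed

lemma kernel_factor:
  assumes c: "conflation E X i Y p Z" and f: "f \<in> Ar E" "Cod E f = Y"
    "Comp E p f = Zer E (Dom E f) Z"
  shows "\<exists>!g. g \<in> Hom E (Dom E f) X \<and> Comp E i g = f"
proof -
  have "(i, p) \<in> Conf E" using c by (simp add: conflation_def)
  from Conf_kernel[OF this] show ?thesis
    using conflationD[OF c] f Dom_in[OF f(1)] unfolding is_kernel_def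
    by (auto simp: Hom_def)
qed

lemma kernel_factorE:
  assumes "conflation E X i Y p Z" "f \<in> Ar E" "Cod E f = Y" "Comp E p f = Zer E (Dom E f) Z"
  obtains g where "g \<in> Ar E" "Dom E g = Dom E f" "Cod E g = X" "Comp E i g = f"
  using kernel_factor[OF assms] by (auto simp: Hom_def)

text \<open>Since \<open>p\<close> kills the common composite, the uniqueness clause of the kernel
  property identifies its two factorizations through \<open>i\<close>.\<close>

lemma kernel_mono:
  assumes c: "conflation E X i Y p Z" and g: "g \<in> Ar E" "Cod E g = X"
    and h: "h \<in> Ar E" "Cod E h = X" "Dom E h = Dom E g" and eq: "Comp E i g = Comp E i h"
  shows "g = h"
proof -
  note D = conflationD[OF c]
  have "Comp E p (Comp E i g) = Comp E (Comp E p i) g"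
    using D(1-9) g by (simp add: arr_simps)
  also have "\<dots> = Zer E (Dom E g) Z"
    using D g by (simp add: arr_simps)
  finally have "\<exists>!k. k \<in> Hom E (Dom E (Comp E i g)) X \<and> Comp E i k = Comp E i g"
    using D g by (intro kernel_factor[OF c]) (auto simp: arr_simps)
  then show ?thesis
    using g h eq D by (auto simp: Hom_def arr_simps)
qed

text \<open>The difference of \<open>f\<close> and \<open>g\<close> is killed by \<open>p\<close>,
  hence factors through the kernel \<open>i\<close>. The splitting arguments below obtain their
  correction terms in this way.\<close>

lemma kernel_difference:
  assumes c: "conflation E X i Y p Z" and f: "f \<in> Ar E" "Dom E f = T" "Cod E f = Y"
    and g: "g \<in> Ar E" "Dom E g = T" "Cod E g = Y" and eq: "Comp E p f = Comp E p g"
  obtains s where "s \<in> Ar E" "Dom E s = T" "Cod E s = X" "f = Add E g (Comp E i s)"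
proof -
  note D = conflationD[OF c]
  obtain d where d: "d \<in> Ar E" "Dom E d = T" "Cod E d = Y" "Add E g d = f"
    using difference_ex[of f g] f g by metis
  have "Add E (Comp E p g) (Comp E p d) = Comp E p f"
    unfolding d(4)[symmetric] using d(1-3) f g D(1-9) by (simp add: arr_simps)
  also have "\<dots> = Comp E p g" by (rule eq)
  finally have "Comp E p d = Zer E (Dom E d) Z"
    using Add_eq_self[of "Comp E p g" "Comp E p d"] d(1-3) f g D(1-9) by (simp add: arr_simps)
  then obtain s where "s \<in> Ar E" "Dom E s = Dom E d" "Cod E s = X" "Comp E i s = d"
    using kernel_factorE[OF c] d by metis
  then show ?thesis using d by (intro that[of s]) simp_all
qed

lemma Proj_Ob: "P \<in> Proj E \<Longrightarrow> P \<in> Ob E"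
  by (simp add: Proj_def)

lemma Proj_lift:
  assumes "P \<in> Proj E" "deflation E p" "p \<in> Ar E" "f \<in> Ar E" "Dom E f = P" "Cod E f = Cod E p"
  obtains g where "g \<in> Ar E" "Dom E g = P" "Cod E g = Dom E p" "Comp E p g = f"
proof -
  have "\<exists>g\<in>Hom E P (Dom E p). Comp E p g = f"
    using assms unfolding Proj_def by (auto simp: Hom_def)
  then show ?thesis using that by (auto simp: Hom_def)
qed

section \<open>Stable retracts\<close>

lemma factors_through_projE:
  assumes "factors_through_proj E f" "Dom E f = X" "Cod E f = Y"
  obtains P a b where "P \<in> Proj E" "a \<in> Ar E" "b \<in> Ar E" "Dom E a = X" "Cod E a = P"
    "Dom E b = P" "Cod E b = Y" "f = Comp E b a"
proof -
  obtain X' Y' P a b where "P \<in> Proj E" "a \<in> Hom E X' P" "b \<in> Hom E P Y'" "f = Comp E b a"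
    using assms(1) unfolding factors_through_proj_def by blast
  then show ?thesis
    using that[of P a b] assms(2,3) by (auto simp: Hom_def arr_Comp)
qed

lemma factors_through_projI:
  assumes "P \<in> Proj E" "a \<in> Ar E" "b \<in> Ar E" "Cod E a = P" "Dom E b = P"
  shows "factors_through_proj E (Comp E b a)"
  using assms unfolding factors_through_proj_def Hom_def by blast

lemma factors_through_proj_Comp:
  assumes f: "factors_through_proj E f" and g: "g \<in> Ar E"
  shows "Dom E g = Cod E f \<Longrightarrow> factors_through_proj E (Comp E g f)"
    and "Cod E g = Dom E f \<Longrightarrow> factors_through_proj E (Comp E f g)"
proof -
  obtain X Y where XY: "Dom E f = X" "Cod E f = Y" by blast
  obtain P a b where *: "P \<in> Proj E" "a \<in> Ar E" "b \<in> Ar E" "Dom E a = X" "Cod E a = P"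
    "Dom E b = P" "Cod E b = Y" "f = Comp E b a"
    by (rule factors_through_projE[OF f XY])
  show "factors_through_proj E (Comp E g f)" if "Dom E g = Cod E f"
    using factors_through_projI[of P a "Comp E g b"] * XY g that by (simp add: arr_simps)
  show "factors_through_proj E (Comp E f g)" if "Cod E g = Dom E f"
    using factors_through_projI[of P "Comp E a g" b] * XY g that by (simp add: arr_simps)
qed

text \<open>A lift on \<open>B\<close> is assembled from lifts of \<open>f i1\<close> and
  \<open>f i2\<close>; the identity \<open>i1 p1 + i2 p2 = 1\<close> makes the pieces add up to
  \<open>f\<close>.\<close>

lemma Proj_biproduct:
  assumes "P \<in> Proj E" "Q \<in> Proj E" "B \<in> Ob E" "is_biproduct E P Q B i1 i2 p1 p2"
  shows "B \<in> Proj E"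
  unfolding Proj_def
proof (intro CollectI conjI allI ballI impI)
  fix Y Z p f
  assume p: "p \<in> Hom E Y Z" and f: "f \<in> Hom E B Z" and d: "deflation E p"
  note pf = HomD[OF p] HomD[OF f]
  have bi: "i1 \<in> Ar E" "Dom E i1 = P" "Cod E i1 = B" "i2 \<in> Ar E" "Dom E i2 = Q" "Cod E i2 = B"
    "p1 \<in> Ar E" "Dom E p1 = B" "Cod E p1 = P" "p2 \<in> Ar E" "Dom E p2 = B" "Cod E p2 = Q"
    "Add E (Comp E i1 p1) (Comp E i2 p2) = Id E B"
    using assms(4) by (auto simp: is_biproduct_def Hom_def)
  obtain g1 where g1: "g1 \<in> Ar E" "Dom E g1 = P" "Cod E g1 = Dom E p" "Comp E p g1 = Comp E f i1"
    using Proj_lift[OF assms(1) d, of "Comp E f i1"] pf bi by (auto simp: arr_simps)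
  obtain g2 where g2: "g2 \<in> Ar E" "Dom E g2 = Q" "Cod E g2 = Dom E p" "Comp E p g2 = Comp E f i2"
    using Proj_lift[OF assms(2) d, of "Comp E f i2"] pf bi by (auto simp: arr_simps)
  let ?g = "Add E (Comp E g1 p1) (Comp E g2 p2)"
  have "Comp E p ?g = Add E (Comp E (Comp E p g1) p1) (Comp E (Comp E p g2) p2)"
    using pf bi(1-12) g1(1-3) g2(1-3) by (simp add: arr_simps)
  also have "\<dots> = Comp E f (Add E (Comp E i1 p1) (Comp E i2 p2))"
    unfolding g1(4) g2(4) using pf bi(1-12) by (simp add: arr_simps)
  also have "\<dots> = f" unfolding bi(13) using pf by (simp add: arr_simps)
  finally show "\<exists>g\<in>Hom E B Y. Comp E p g = f"
    using pf bi(1-12) g1(1-3) g2(1-3) by (intro bexI[of _ ?g]) (auto simp: Hom_def arr_simps)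
qed (use assms in auto)

text \<open>The sum factors through the biproduct of the two projectives, entering by
  \<open>a\<close> and \<open>a'\<close> and leaving by \<open>b\<close> and \<open>b'\<close>; the
  cross terms vanish.\<close>

lemma factors_through_proj_Add:
  assumes f: "factors_through_proj E f" and g: "factors_through_proj E g"
    and fg: "Dom E g = Dom E f" "Cod E g = Cod E f"
  shows "factors_through_proj E (Add E f g)"
proof -
  obtain X Y where XY: "Dom E f = X" "Cod E f = Y" by blast
  obtain P a b where 1: "P \<in> Proj E" "a \<in> Ar E" "b \<in> Ar E" "Dom E a = X" "Cod E a = P"
    "Dom E b = P" "Cod E b = Y" "f = Comp E b a"
    by (rule factors_through_projE[OF f XY])
  have D: "X \<in> Ob E" using 1(2,4) Dom_in by metis
  obtain Q a' b' where 2: "Q \<in> Proj E" "a' \<in> Ar E" "b' \<in> Ar E" "Dom E a' = X" "Cod E a' = Q"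
    "Dom E b' = Q" "Cod E b' = Y" "g = Comp E b' a'"
    by (rule factors_through_projE[OF g fg[unfolded XY]])
  obtain B i1 i2 p1 p2 where B: "B \<in> Ob E" "is_biproduct E P Q B i1 i2 p1 p2"
    using biproduct_ex[OF Proj_Ob[OF 1(1)] Proj_Ob[OF 2(1)]] by blast
  have bi: "i1 \<in> Ar E" "Dom E i1 = P" "Cod E i1 = B" "i2 \<in> Ar E" "Dom E i2 = Q" "Cod E i2 = B"
    "p1 \<in> Ar E" "Dom E p1 = B" "Cod E p1 = P" "p2 \<in> Ar E" "Dom E p2 = B" "Cod E p2 = Q"
    and eq: "Comp E p1 i1 = Id E P" "Comp E p2 i2 = Id E Q" "Comp E p1 i2 = Zer E Q P"
    "Comp E p2 i1 = Zer E P Q"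
    using B(2) by (auto simp: is_biproduct_def Hom_def)
  let ?a = "Add E (Comp E i1 a) (Comp E i2 a')" and ?b = "Add E (Comp E b p1) (Comp E b' p2)"
  have eq': "Comp E p1 (Comp E i1 a) = a" "Comp E p2 (Comp E i2 a') = a'"
    "Comp E p1 (Comp E i2 a') = Zer E X P" "Comp E p2 (Comp E i1 a) = Zer E X Q"
    using arr_assoc[of a i1 p1] arr_assoc[of a' i2 p2] arr_assoc[of a' i2 p1] arr_assoc[of a i1 p2]
      1(1-7) 2(1-7) bi eq by (auto simp: arr_simps Proj_Ob)
  have "Comp E ?b ?a = Add E f g"
    unfolding 1(8) 2(8) using 1(1-7) 2(1-7) bi eq' D by (simp add: arr_simps Proj_Ob)
  moreover have "factors_through_proj E (Comp E ?b ?a)"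
    using 1(1-7) 2(1-7) bi Proj_biproduct[OF 1(1) 2(1) B]
    by (intro factors_through_projI) (auto simp: arr_simps)
  ultimately show ?thesis by simp
qed

text \<open>Morphisms out of a zero object are unique. This puts zero morphisms into the ideal, as
  reflexivity of the stable congruence requires.\<close>

lemma zero_object_Proj:
  assumes "zero_object E Z"
  shows "Z \<in> Proj E"
  unfolding Proj_def
proof (intro CollectI conjI allI ballI impI)
  show Z: "Z \<in> Ob E" using assms by (simp add: zero_object_def)
  fix Y W p f
  assume p: "p \<in> Hom E Y W" and f: "f \<in> Hom E Z W"
  have Y: "Y \<in> Ob E" "W \<in> Ob E" using HomD[OF p] Dom_in Cod_in by auto
  have "Comp E p (Zer E Z Y) \<in> Hom E Z W" "Zer E Z Y \<in> Hom E Z Y"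
    using HomD[OF p] Y Z by (auto simp: Hom_def arr_simps)
  moreover have "\<exists>!f. f \<in> Hom E Z W" using assms Y by (simp add: zero_object_def)
  ultimately show "\<exists>g\<in>Hom E Z Y. Comp E p g = f" using f by blast
qed

lemma factors_through_proj_Zer:
  assumes "X \<in> Ob E" "Y \<in> Ob E"
  shows "factors_through_proj E (Zer E X Y)"
proof -
  obtain Z where Z: "Z \<in> Proj E" using zero_object_ex zero_object_Proj by blast
  note Proj_Ob[OF Z]
  then have "Zer E X Y = Comp E (Zer E Z Y) (Zer E X Z)"
    using assms by (simp add: arr_simps)
  then show ?thesis
    using factors_through_projI[OF Z, of "Zer E X Z" "Zer E Z Y"] assms Proj_Ob[OF Z]
    by (simp add: arr_simps)
qed

text \<open>Negating the outgoing factor keeps the projective in the middle. Symmetry of the stable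
  congruence rests on this.\<close>

lemma factors_through_proj_negative:
  assumes f: "factors_through_proj E f"
  obtains g where "g \<in> Ar E" "Dom E g = Dom E f" "Cod E g = Cod E f" "factors_through_proj E g"
    "Add E f g = Zer E (Dom E f) (Cod E f)"
proof -
  obtain X Y where XY: "Dom E f = X" "Cod E f = Y" by blast
  obtain P a b where *: "P \<in> Proj E" "a \<in> Ar E" "b \<in> Ar E" "Dom E a = X" "Cod E a = P"
    "Dom E b = P" "Cod E b = Y" "f = Comp E b a"
    by (rule factors_through_projE[OF f XY])
  have Ob: "P \<in> Ob E" "Y \<in> Ob E" "X \<in> Ob E" using * Cod_in Dom_in Proj_Ob by metis+
  obtain c where c: "c \<in> Ar E" "Dom E c = P" "Cod E c = Y" "Add E b c = Zer E P Y"
    using difference_ex[of "Zer E P Y" b] * Ob by (auto simp: arr_simps)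
  have "Add E (Comp E b a) (Comp E c a) = Comp E (Add E b c) a"
    using *(1-7) c(1-3) Ob by (simp add: arr_simps)
  also have "\<dots> = Zer E X Y"
    unfolding c(4) using *(1-7) c(1-3) Ob by (simp add: arr_simps)
  finally have "Add E f (Comp E c a) = Zer E X Y" by (simp add: *(8))
  then show ?thesis
    using that[of "Comp E c a"] factors_through_projI[of P a c] *(1-7) c(1-3) XY
    by (simp add: arr_simps)
qed

section \<open>The stable category as a quotient, and its retracts\<close>

lemma stable_rel_iff:
  "(f, g) \<in> stable_rel E \<longleftrightarrow> g \<in> Ar E \<and>
     (\<exists>h. h \<in> Ar E \<and> Dom E h = Dom E g \<and> Cod E h = Cod E g \<and> factors_through_proj E h \<and>
        f = Add E g h)"
proof
  assume "(f, g) \<in> stable_rel E"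
  then show "g \<in> Ar E \<and> (\<exists>h. h \<in> Ar E \<and> Dom E h = Dom E g \<and> Cod E h = Cod E g \<and>
      factors_through_proj E h \<and> f = Add E g h)"
    unfolding stable_rel_def Hom_def by auto
next
  assume "g \<in> Ar E \<and> (\<exists>h. h \<in> Ar E \<and> Dom E h = Dom E g \<and> Cod E h = Cod E g \<and>
      factors_through_proj E h \<and> f = Add E g h)"
  then obtain h where *: "g \<in> Ar E" "h \<in> Ar E" "Dom E h = Dom E g" "Cod E h = Cod E g"
    "factors_through_proj E h" "f = Add E g h" by blast
  from arr_Add[OF *(1-4)] have "f \<in> Hom E (Dom E g) (Cod E g)" by (simp add: Hom_def *(6))
  moreover have "g \<in> Hom E (Dom E g) (Cod E g)" "h \<in> Hom E (Dom E g) (Cod E g)"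
    using * by (simp_all add: Hom_def)
  ultimately show "(f, g) \<in> stable_rel E"
    unfolding stable_rel_def using *(5,6) by blast
qed

lemma stable_rel_parallel:
  assumes "(f, g) \<in> stable_rel E"
  shows "f \<in> Ar E" "g \<in> Ar E" "Dom E f = Dom E g" "Cod E f = Cod E g"
  using assms unfolding stable_rel_def by (auto simp: Hom_def)

lemma equiv_stable_rel: "equiv (Ar E) (stable_rel E)"
proof (rule equivI)
  show "stable_rel E \<subseteq> Ar E \<times> Ar E"
    using stable_rel_parallel by auto
  show "refl_on (Ar E) (stable_rel E)"
  proof (rule refl_onI)
    fix f assume "f \<in> Ar E"
    then show "(f, f) \<in> stable_rel E"
      unfolding stable_rel_iff using factors_through_proj_Zer[of "Dom E f" "Cod E f"]
      by (intro conjI exI[of _ "Zer E (Dom E f) (Cod E f)"]) (auto simp: arr_simps)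
  qed
  show "sym (stable_rel E)"
  proof (rule symI)
    fix f g assume "(f, g) \<in> stable_rel E"
    then obtain h where g: "g \<in> Ar E" and h: "h \<in> Ar E" "Dom E h = Dom E g" "Cod E h = Cod E g"
      "factors_through_proj E h" and f: "f = Add E g h"
      by (auto simp: stable_rel_iff)
    obtain h' where h': "h' \<in> Ar E" "Dom E h' = Dom E h" "Cod E h' = Cod E h" "factors_through_proj E h'"
      "Add E h h' = Zer E (Dom E h) (Cod E h)"
      using factors_through_proj_negative[OF h(4)] by blast
    have "Add E f h' = Add E g (Add E h h')"
      unfolding f using g h(1-3) h'(1-3) by (simp add: arr_simps)
    also have "\<dots> = g" unfolding h'(5) using g h(1-3) by (simp add: arr_simps)
    finally show "(g, f) \<in> stable_rel E"
      unfolding stable_rel_iff using g h(1-3) h'(1-4) f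
      by (intro conjI exI[of _ h']) (auto simp: arr_simps)
  qed
  show "trans (stable_rel E)"
  proof (rule transI)
    fix f g k assume "(f, g) \<in> stable_rel E" "(g, k) \<in> stable_rel E"
    then obtain h h' where k: "k \<in> Ar E" and h: "h \<in> Ar E" "Dom E h = Dom E k" "Cod E h = Cod E k"
      "factors_through_proj E h" "h' \<in> Ar E" "Dom E h' = Dom E k" "Cod E h' = Cod E k"
      "factors_through_proj E h'" and f: "f = Add E (Add E k h) h'"
      by (auto simp: stable_rel_iff arr_simps)
    show "(f, k) \<in> stable_rel E"
      unfolding stable_rel_iff using k h f factors_through_proj_Add[OF h(4,8)]
      by (intro conjI exI[of _ "Add E h h'"]) (auto simp: arr_simps)
  qed
qed

lemma stable_Comp:
  assumes f: "(f, f') \<in> stable_rel E" and g: "(g, g') \<in> stable_rel E"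
    and comp: "Dom E g' = Cod E f'"
  shows "(Comp E g f, Comp E g' f') \<in> stable_rel E"
proof -
  obtain h where f': "f' \<in> Ar E" and h: "h \<in> Ar E" "Dom E h = Dom E f'" "Cod E h = Cod E f'"
    "factors_through_proj E h" and f_eq: "f = Add E f' h"
    using f by (auto simp: stable_rel_iff)
  obtain k where g': "g' \<in> Ar E" and k: "k \<in> Ar E" "Dom E k = Dom E g'" "Cod E k = Cod E g'"
    "factors_through_proj E k" and g_eq: "g = Add E g' k"
    using g by (auto simp: stable_rel_iff)
  \<comment> \<open>Expanding \<open>g f = (g' + k) f\<close> and then
    \<open>g' f = g' (f' + h)\<close> leaves these two error terms, both in the ideal.\<close>
  let ?l = "Add E (Comp E g' h) (Comp E k f)"
  have fA: "f \<in> Ar E" "Dom E f = Dom E f'" "Cod E f = Cod E f'"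
    using stable_rel_parallel[OF f] by auto
  have "Comp E g f = Add E (Comp E g' f) (Comp E k f)"
    unfolding g_eq using fA g' k comp by (simp add: arr_simps)
  also have "Comp E g' f = Add E (Comp E g' f') (Comp E g' h)"
    unfolding f_eq using h f' g' comp by (simp add: arr_simps)
  finally have "Comp E g f = Add E (Comp E g' f') ?l"
    using h(1-3) fA g' k(1-3) f' comp by (simp add: arr_simps)
  moreover have "factors_through_proj E ?l"
    using factors_through_proj_Comp(1)[OF h(4), of g'] factors_through_proj_Comp(2)[OF k(4), of f] h(1-3) fA g' k(1-3) f' comp
    by (intro factors_through_proj_Add) (auto simp: arr_simps)
  ultimately show ?thesis
    unfolding stable_rel_iff using h(1-3) fA g' k(1-3) f' comp
    by (intro conjI exI[of _ ?l]) (auto simp: arr_simps)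
qed

lemma stable_Hom:
  "Hom (stable_category E) X Y = (\<lambda>f. stable_rel E `` {f}) ` Hom E X Y"
proof -
  \<comment> \<open>Domain and codomain of a class are definite descriptions; they are determined
    because congruent morphisms are parallel.\<close>
  have dom: "Dom (stable_category E) (stable_rel E `` {f}) = Dom E f" 
    and cod: "Cod (stable_category E) (stable_rel E `` {f}) = Cod E f" if "f \<in> Ar E" for f
  proof -
    have f: "f \<in> stable_rel E `` {f}"
      by (rule equiv_class_self[OF equiv_stable_rel that])
    have *: "Dom E g = Dom E f" "Cod E g = Cod E f" if "g \<in> stable_rel E `` {f}" for g
      using that stable_rel_parallel[of f g] by simp_all
    show "Dom (stable_category E) (stable_rel E `` {f}) = Dom E f"
      unfolding stable_category_def cat.simps using f * by (intro the_equality) blast+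
    show "Cod (stable_category E) (stable_rel E `` {f}) = Cod E f"
      unfolding stable_category_def cat.simps using f * by (intro the_equality) blast+
  qed
  have "Ar (stable_category E) = {stable_rel E `` {f} | f. f \<in> Ar E}"
    unfolding stable_category_def cat.simps quotient_def by blast
  then show ?thesis
    unfolding Hom_def using dom cod by auto
qed

lemma stable_category_Comp:
  assumes f: "f \<in> Ar E" and g: "g \<in> Ar E" and comp: "Dom E g = Cod E f"
  shows "Comp (stable_category E) (stable_rel E `` {g}) (stable_rel E `` {f})
    = stable_rel E `` {Comp E g f}"
proof -
  \<comment> \<open>Composition of classes is a union over all pairs of representatives, so every
    pair must give the same class.\<close>
  have eq: "stable_rel E `` {Comp E g' f'} = stable_rel E `` {Comp E g f}"
    if "g' \<in> stable_rel E `` {g}" "f' \<in> stable_rel E `` {f}" for f' g'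
  proof -
    have gg: "(g, g') \<in> stable_rel E" and ff: "(f, f') \<in> stable_rel E"
      using that by auto
    have "Dom E g' = Cod E f'"
      using stable_rel_parallel[OF gg] stable_rel_parallel[OF ff] comp by simp
    from stable_Comp[OF ff gg this] show ?thesis
      using equiv_class_eq[OF equiv_stable_rel] by blast
  qed
  have "g \<in> stable_rel E `` {g}" "f \<in> stable_rel E `` {f}"
    using equiv_class_self[OF equiv_stable_rel] f g by blast+
  then show ?thesis
    unfolding stable_category_def cat.simps using eq by blast
qed

text \<open>Choosing representatives turns the retract equation of the quotient into an equation in
  \<open>E\<close> with an error term \<open>h\<close>. All later arguments work with this
  equation.\<close>

lemma stable_retract_iff:
  "stable_retract E X Y \<longleftrightarrow> (\<exists>u v h. u \<in> Hom E X Y \<and> v \<in> Hom E Y X \<and> h \<in> Hom E X X \<and>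
     factors_through_proj E h \<and> Id E X = Add E (Comp E v u) h)"
proof -
  have id: "Id (stable_category E) X = stable_rel E `` {Id E X}"
    by (simp add: stable_category_def)
  have "stable_retract E X Y \<longleftrightarrow>
    (\<exists>u \<in> Hom E X Y. \<exists>v \<in> Hom E Y X. Comp (stable_category E) (stable_rel E `` {v}) (stable_rel E `` {u})
      = stable_rel E `` {Id E X})"
    unfolding stable_retract_def is_retract_def stable_Hom id by blast
  also have "\<dots> \<longleftrightarrow> (\<exists>u \<in> Hom E X Y. \<exists>v \<in> Hom E Y X.
      stable_rel E `` {Comp E v u} = stable_rel E `` {Id E X})"
    by (intro bex_cong refl) (simp add: Hom_def stable_category_Comp)
  also have "\<dots> \<longleftrightarrow> (\<exists>u \<in> Hom E X Y. \<exists>v \<in> Hom E Y X. (Id E X, Comp E v u) \<in> stable_rel E)"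
  proof (intro bex_cong refl)
    fix u v assume uv: "u \<in> Hom E X Y" "v \<in> Hom E Y X"
    then have "Comp E v u \<in> Ar E" "Id E X \<in> Ar E" by (auto simp: Hom_def arr_simps)
    then show "(stable_rel E `` {Comp E v u} = stable_rel E `` {Id E X}) =
        ((Id E X, Comp E v u) \<in> stable_rel E)"
      using eq_equiv_class_iff[OF equiv_stable_rel, of "Id E X" "Comp E v u"] by auto
  qed
  also have "\<dots> \<longleftrightarrow> (\<exists>u v h. u \<in> Hom E X Y \<and> v \<in> Hom E Y X \<and> h \<in> Hom E X X \<and>
     factors_through_proj E h \<and> Id E X = Add E (Comp E v u) h)" (is "?L \<longleftrightarrow> ?R")
  proof
    assume ?L
    then obtain u v where uv: "u \<in> Hom E X Y" "v \<in> Hom E Y X" "(Id E X, Comp E v u) \<in> stable_rel E"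
      by blast
    then obtain h where h: "h \<in> Ar E" "Dom E h = Dom E (Comp E v u)" "Cod E h = Cod E (Comp E v u)"
      and h': "factors_through_proj E h" "Id E X = Add E (Comp E v u) h"
      unfolding stable_rel_iff by blast
    have "h \<in> Hom E X X"
      using h uv(1,2) by (simp add: Hom_def arr_Comp)
    then show ?R using uv(1,2) h' by blast
  next
    assume ?R
    then obtain u v h where *: "u \<in> Hom E X Y" "v \<in> Hom E Y X" "h \<in> Hom E X X"
      "factors_through_proj E h" "Id E X = Add E (Comp E v u) h" by blast
    then have "Comp E v u \<in> Hom E X X" by (intro Comp_in)
    then have "(Id E X, Comp E v u) \<in> stable_rel E"
      unfolding stable_rel_iff using *(3-5) by (intro conjI exI[of _ h]) (simp_all add: Hom_def)
    then show ?L using * by blast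
  qed
  finally show ?thesis .
qed

lemma stable_retractE:
  assumes "stable_retract E X Y"
  obtains u v h where "u \<in> Ar E" "Dom E u = X" "Cod E u = Y" "v \<in> Ar E" "Dom E v = Y" "Cod E v = X"
    "h \<in> Ar E" "Dom E h = X" "Cod E h = X" "factors_through_proj E h"
    "Add E (Comp E v u) h = Id E X"
proof -
  from assms obtain u v h where "u \<in> Hom E X Y" "v \<in> Hom E Y X" "h \<in> Hom E X X"
    "factors_through_proj E h" "Id E X = Add E (Comp E v u) h"
    unfolding stable_retract_iff by blast
  then show ?thesis by (intro that[of u v h]) (simp_all add: Hom_def)
qed

lemma stable_retractI:
  assumes "u \<in> Ar E" "Dom E u = X" "Cod E u = Y" "v \<in> Ar E" "Dom E v = Y" "Cod E v = X"
    "h \<in> Ar E" "Dom E h = X" "Cod E h = X" "factors_through_proj E h"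
    "Add E (Comp E v u) h = Id E X"
  shows "stable_retract E X Y"
  unfolding stable_retract_iff
  using assms by (intro exI[of _ u] exI[of _ v] exI[of _ h]) (simp add: Hom_def)

section \<open>Stable retracts as a preorder, and comparison of syzygies\<close>

lemma retract_imp_stable_retract:
  assumes "u \<in> Ar E" "Dom E u = X" "Cod E u = Y" "v \<in> Ar E" "Dom E v = Y" "Cod E v = X"
    "Comp E v u = Id E X"
  shows "stable_retract E X Y"
proof -
  have X: "X \<in> Ob E" using assms(1,2) Dom_in[of u] by simp
  then show ?thesis
    using assms factors_through_proj_Zer[OF X X] by (intro stable_retractI[of u X Y v "Zer E X X"]) (auto simp: arr_simps)
qed

lemma stable_retract_Ob:
  assumes "stable_retract E X Y"
  shows "X \<in> Ob E" "Y \<in> Ob E"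
proof -
  obtain u v where "u \<in> Hom E X Y" "v \<in> Hom E Y X"
    using assms unfolding stable_retract_iff by blast
  then show "X \<in> Ob E" "Y \<in> Ob E" using Dom_in[of u] Cod_in[of u] by (auto simp: Hom_def)
qed

lemma stable_retract_refl: "X \<in> Ob E \<Longrightarrow> stable_retract E X X"
  by (rule retract_imp_stable_retract[of "Id E X" _ _ "Id E X"]) (auto simp: arr_simps)

lemma stable_retract_trans:
  assumes XY: "stable_retract E X Y" and YZ: "stable_retract E Y Z"
  shows "stable_retract E X Z"
proof -
  obtain u v h where 1: "u \<in> Ar E" "Dom E u = X" "Cod E u = Y" "v \<in> Ar E" "Dom E v = Y" "Cod E v = X"
    "h \<in> Ar E" "Dom E h = X" "Cod E h = X" "factors_through_proj E h"
    "Add E (Comp E v u) h = Id E X"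
    by (rule stable_retractE[OF XY])
  obtain u' v' h' where 2: "u' \<in> Ar E" "Dom E u' = Y" "Cod E u' = Z" "v' \<in> Ar E" "Dom E v' = Z" "Cod E v' = Y"
    "h' \<in> Ar E" "Dom E h' = Y" "Cod E h' = Y" "factors_through_proj E h'"
    "Add E (Comp E v' u') h' = Id E Y"
    by (rule stable_retractE[OF YZ])
  \<comment> \<open>The term \<open>v h' u\<close> arises from inserting
    \<open>1 = v' u' + h'\<close> at \<open>Y\<close> between \<open>u\<close> and
    \<open>v\<close>.\<close>
  let ?h = "Add E (Comp E v (Comp E h' u)) h"
  have Y: "Y \<in> Ob E" using 1(1,3) Cod_in[of u] by simp
  have "Comp E v u = Comp E v (Comp E (Add E (Comp E v' u') h') u)"
    unfolding 2(11) using 1 Y by (simp add: arr_simps)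
  also have "\<dots> = Add E (Comp E v (Comp E v' (Comp E u' u))) (Comp E v (Comp E h' u))"
    using 1(1-9) 2(1-9) by (simp add: arr_simps)
  finally have "Add E (Comp E (Comp E v v') (Comp E u' u)) ?h = Add E (Comp E v u) h"
    using 1(1-9) 2(1-9) by (simp add: arr_simps)
  moreover have "factors_through_proj E (Comp E v (Comp E h' u))"
    using factors_through_proj_Comp(1)[of "Comp E h' u" v] factors_through_proj_Comp(2)[OF 2(10), of u] 1(1-9) 2(1-9)
    by (simp add: arr_simps)
  then have "factors_through_proj E ?h"
    using 1(1-10) 2(1-9) by (intro factors_through_proj_Add) (auto simp: arr_simps)
  ultimately show ?thesis
    using 1 2(1-9) by (intro stable_retractI[of "Comp E u' u" _ _ "Comp E v v'" ?h]) (auto simp: arr_simps)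
qed

text \<open>With \<open>1 = v u + b a\<close>, a morphism \<open>f\<close> out of \<open>X\<close>
  equals \<open>(f v) u + (f b) a\<close>; both brackets start at projectives and therefore
  lift.\<close>

lemma stable_retract_Proj:
  assumes XY: "stable_retract E X Y" and Y: "Y \<in> Proj E"
  shows "X \<in> Proj E"
  unfolding Proj_def
proof (intro CollectI conjI allI ballI impI)
  show X: "X \<in> Ob E" using stable_retract_Ob[OF XY] by simp
  fix V W p f
  assume "p \<in> Hom E V W" "f \<in> Hom E X W" and d: "deflation E p"
  then have pf: "p \<in> Ar E" "Dom E p = V" "Cod E p = W" "f \<in> Ar E" "Dom E f = X" "Cod E f = W"
    by (auto simp: Hom_def)
  obtain u v h where 1: "u \<in> Ar E" "Dom E u = X" "Cod E u = Y" "v \<in> Ar E" "Dom E v = Y" "Cod E v = X"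
    "h \<in> Ar E" "Dom E h = X" "Cod E h = X" "factors_through_proj E h"
    "Add E (Comp E v u) h = Id E X"
    by (rule stable_retractE[OF XY])
  obtain P a b where 2: "P \<in> Proj E" "a \<in> Ar E" "b \<in> Ar E" "Dom E a = X" "Cod E a = P"
    "Dom E b = P" "Cod E b = X" "h = Comp E b a"
    by (rule factors_through_projE[OF 1(10,8,9)])
  obtain g where g: "g \<in> Ar E" "Dom E g = Y" "Cod E g = V" "Comp E p g = Comp E f v"
    using Proj_lift[OF Y d, of "Comp E f v"] pf 1(1-9) by (auto simp: arr_simps)
  obtain k where k: "k \<in> Ar E" "Dom E k = P" "Cod E k = V" "Comp E p k = Comp E f b"
    using Proj_lift[OF 2(1) d, of "Comp E f b"] pf 2(2-7) by (auto simp: arr_simps)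
  let ?g = "Add E (Comp E g u) (Comp E k a)"
  have "Comp E p ?g = Add E (Comp E (Comp E p g) u) (Comp E (Comp E p k) a)"
    using pf 1(1-6) 2(2-7) g(1-3) k(1-3) by (simp add: arr_simps)
  also have "\<dots> = Comp E f (Add E (Comp E v u) h)"
    unfolding g(4) k(4) 2(8) using pf 1(1-6) 2(2-7) by (simp add: arr_simps)
  also have "\<dots> = f" unfolding 1(11) using pf by (simp add: arr_simps)
  finally show "\<exists>g\<in>Hom E X V. Comp E p g = f"
    using pf 1(1-6) 2(2-7) g(1-3) k(1-3) by (intro bexI[of _ ?g]) (auto simp: Hom_def arr_simps)
qed

text \<open>Right-nested normal forms hide \<open>g f\<close> inside \<open>g (f x)\<close>; this
  rule makes a known composite usable there.\<close>

lemma comp_reassoc: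
  assumes "Comp E g f = k" "f \<in> Ar E" "g \<in> Ar E" "x \<in> Ar E" "Dom E g = Cod E f" "Dom E f = Cod E x"
  shows "Comp E g (Comp E f x) = Comp E k x"
  using arr_assoc[of x f g] assms by simp

text \<open>Projectivity lifts \<open>f p\<close> to \<open>f0\<close>, and \<open>f0 i\<close>
  lands in the kernel \<open>L\<close> because \<open>f p i = 0\<close>.\<close>

lemma lift_to_syzygies:
  assumes KP: "conflation E K i P p X" and P: "P \<in> Proj E" and LQ: "conflation E L j Q q Y"
    and f: "f \<in> Ar E" "Dom E f = X" "Cod E f = Y"
  obtains f0 f1 where "f0 \<in> Ar E" "Dom E f0 = P" "Cod E f0 = Q" "f1 \<in> Ar E" "Dom E f1 = K" "Cod E f1 = L"
    "Comp E q f0 = Comp E f p" "Comp E f0 i = Comp E j f1"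
proof -
  note i = conflationD[OF KP] and j = conflationD[OF LQ]
  obtain f0 where f0: "f0 \<in> Ar E" "Dom E f0 = P" "Cod E f0 = Q" "Comp E q f0 = Comp E f p"
    using Proj_lift[OF P j(11,4), of "Comp E f p"] f i(1-9) j(5,6) by (auto simp: arr_simps)
  have "Comp E q (Comp E f0 i) = Comp E f (Comp E p i)"
    using comp_reassoc[OF f0(4)] f0(1-3) f i(1-9) j(1-9) by (simp add: arr_simps)
  also have "\<dots> = Zer E K Y" unfolding i(10) using f i(1-9) by (simp add: arr_simps)
  finally obtain f1 where "f1 \<in> Ar E" "Dom E f1 = K" "Cod E f1 = L" "Comp E j f1 = Comp E f0 i"
    using kernel_factorE[OF LQ, of "Comp E f0 i"] f0(1-3) i(1-9) j(1-9) by (auto simp: arr_simps)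
  then show ?thesis using f0 by (intro that[of f0 f1]) simp_all
qed

end

text \<open>Up to projective summands, \<open>X\<close> is a retract of \<open>Y \<oplus> R\<close>.\<close>

definition stable_retract_of_sum :: "('o, 'm, 'z) exact_cat_scheme \<Rightarrow> 'o \<Rightarrow> 'o \<Rightarrow> 'o \<Rightarrow> bool" where
  "stable_retract_of_sum E X Y R \<longleftrightarrow> (\<exists>u \<in> Hom E X Y. \<exists>v \<in> Hom E Y X. \<exists>a \<in> Hom E X R. \<exists>b \<in> Hom E R X.
     \<exists>h \<in> Hom E X X. factors_through_proj E h \<and>
       Add E (Comp E v u) (Add E (Comp E b a) h) = Id E X)"

section \<open>Retracts of sums and their passage to kernels\<close>

context exact_category
begin

lemma stable_retract_of_sumE:
  assumes "stable_retract_of_sum E X Y R"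
  obtains u v a b h where
    "u \<in> Ar E" "Dom E u = X" "Cod E u = Y" "v \<in> Ar E" "Dom E v = Y" "Cod E v = X"
    "a \<in> Ar E" "Dom E a = X" "Cod E a = R" "b \<in> Ar E" "Dom E b = R" "Cod E b = X"
    "h \<in> Ar E" "Dom E h = X" "Cod E h = X" "factors_through_proj E h"
    "Add E (Comp E v u) (Add E (Comp E b a) h) = Id E X"
proof -
  from assms obtain u v a b h where "u \<in> Hom E X Y" "v \<in> Hom E Y X" "a \<in> Hom E X R" "b \<in> Hom E R X"
    "h \<in> Hom E X X" "factors_through_proj E h" "Add E (Comp E v u) (Add E (Comp E b a) h) = Id E X"
    unfolding stable_retract_of_sum_def by blast
  then show ?thesis by (intro that[of u v a b h]) (simp_all add: Hom_def)
qed

lemma stable_retract_of_sumI: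
  assumes
    "u \<in> Ar E" "Dom E u = X" "Cod E u = Y" "v \<in> Ar E" "Dom E v = Y" "Cod E v = X"
    "a \<in> Ar E" "Dom E a = X" "Cod E a = R" "b \<in> Ar E" "Dom E b = R" "Cod E b = X"
    "h \<in> Ar E" "Dom E h = X" "Cod E h = X" "factors_through_proj E h"
    "Add E (Comp E v u) (Add E (Comp E b a) h) = Id E X"
  shows "stable_retract_of_sum E X Y R"
  unfolding stable_retract_of_sum_def
  using assms by (intro bexI[of _ u] bexI[of _ v] bexI[of _ a] bexI[of _ b] bexI[of _ h])
    (simp_all add: Hom_def)

text \<open>The projective through which the error factors becomes the explicit summand
  \<open>R\<close>, so that its syzygies can be followed separately.\<close>

lemma stable_retract_imp_sum:
  assumes "stable_retract E X Y"
  obtains R where "R \<in> Proj E" "stable_retract_of_sum E X Y R"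
proof -
  obtain u v h where 1: "u \<in> Ar E" "Dom E u = X" "Cod E u = Y" "v \<in> Ar E" "Dom E v = Y" "Cod E v = X"
    "h \<in> Ar E" "Dom E h = X" "Cod E h = X" "factors_through_proj E h"
    "Add E (Comp E v u) h = Id E X"
    by (rule stable_retractE[OF assms])
  obtain P a b where 2: "P \<in> Proj E" "a \<in> Ar E" "b \<in> Ar E" "Dom E a = X" "Cod E a = P"
    "Dom E b = P" "Cod E b = X" "h = Comp E b a"
    by (rule factors_through_projE[OF 1(10,8,9)])
  have X: "X \<in> Ob E" using stable_retract_Ob[OF assms] by simp
  have "Add E (Comp E v u) (Add E (Comp E b a) (Zer E X X)) = Id E X"
    using 1(7-9,11) 2(8) X by (simp add: arr_simps)
  then have "stable_retract_of_sum E X Y P"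
    using 1(1-6) 2(2-7) X factors_through_proj_Zer[OF X X]
    by (intro stable_retract_of_sumI[of u X Y v a P b "Zer E X X"]) (simp_all add: arr_simps)
  then show ?thesis using 2(1) that by blast
qed

text \<open>For projective \<open>R\<close> the term \<open>b a\<close> belongs to the ideal and
  joins the error.\<close>

lemma stable_retract_of_sum_Proj:
  assumes "stable_retract_of_sum E X Y R" "R \<in> Proj E"
  shows "stable_retract E X Y"
proof -
  obtain u v a b h where *:
    "u \<in> Ar E" "Dom E u = X" "Cod E u = Y" "v \<in> Ar E" "Dom E v = Y" "Cod E v = X"
    "a \<in> Ar E" "Dom E a = X" "Cod E a = R" "b \<in> Ar E" "Dom E b = R" "Cod E b = X"
    "h \<in> Ar E" "Dom E h = X" "Cod E h = X" "factors_through_proj E h"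
    "Add E (Comp E v u) (Add E (Comp E b a) h) = Id E X"
    by (rule stable_retract_of_sumE[OF assms(1)])
  have "factors_through_proj E (Add E (Comp E b a) h)"
    using *(1-16) by (intro factors_through_proj_Add factors_through_projI[OF assms(2)]) (simp_all add: arr_simps)
  then show ?thesis
    using * by (intro stable_retractI[of u X Y v "Add E (Comp E b a) h"]) (simp_all add: arr_simps)
qed

text \<open>The equation \<open>1 = v u + b a + h\<close> is lifted to the projectives and
  restricted to kernels. On \<open>P\<close> it holds up to a map \<open>i s\<close>, whose
  restriction contributes \<open>s i\<close>, an error through \<open>P\<close>.\<close>

lemma stable_retract_of_sum_kernels:
  assumes XYR: "stable_retract_of_sum E X Y R"
    and KP: "conflation E K i P p X" and P: "P \<in> Proj E"
    and LQ: "conflation E L j Q q Y" and Q: "Q \<in> Proj E"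
    and MT: "conflation E M m T t R" and T: "T \<in> Proj E"
  shows "stable_retract_of_sum E K L M"
proof -
  note i = conflationD[OF KP] and j = conflationD[OF LQ] and m = conflationD[OF MT]
  obtain u v a b h where 1:
    "u \<in> Ar E" "Dom E u = X" "Cod E u = Y" "v \<in> Ar E" "Dom E v = Y" "Cod E v = X"
    "a \<in> Ar E" "Dom E a = X" "Cod E a = R" "b \<in> Ar E" "Dom E b = R" "Cod E b = X"
    "h \<in> Ar E" "Dom E h = X" "Cod E h = X" "factors_through_proj E h"
    and id: "Add E (Comp E v u) (Add E (Comp E b a) h) = Id E X"
    by (rule stable_retract_of_sumE[OF XYR])
  obtain S e d where 2: "S \<in> Proj E" "e \<in> Ar E" "d \<in> Ar E" "Dom E e = X" "Cod E e = S"
    "Dom E d = S" "Cod E d = X" "h = Comp E d e"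
    by (rule factors_through_projE[OF 1(16,14,15)])
  obtain u0 u1 where u: "u0 \<in> Ar E" "Dom E u0 = P" "Cod E u0 = Q" "u1 \<in> Ar E" "Dom E u1 = K" "Cod E u1 = L"
    and u_eq: "Comp E q u0 = Comp E u p" "Comp E u0 i = Comp E j u1"
    by (rule lift_to_syzygies[OF KP P LQ 1(1-3)])
  obtain v0 v1 where v: "v0 \<in> Ar E" "Dom E v0 = Q" "Cod E v0 = P" "v1 \<in> Ar E" "Dom E v1 = L" "Cod E v1 = K"
    and v_eq: "Comp E p v0 = Comp E v q" "Comp E v0 j = Comp E i v1"
    by (rule lift_to_syzygies[OF LQ Q KP 1(4-6)])
  obtain a0 a1 where a: "a0 \<in> Ar E" "Dom E a0 = P" "Cod E a0 = T" "a1 \<in> Ar E" "Dom E a1 = K" "Cod E a1 = M"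
    and a_eq: "Comp E t a0 = Comp E a p" "Comp E a0 i = Comp E m a1"
    by (rule lift_to_syzygies[OF KP P MT 1(7-9)])
  obtain b0 b1 where b: "b0 \<in> Ar E" "Dom E b0 = T" "Cod E b0 = P" "b1 \<in> Ar E" "Dom E b1 = M" "Cod E b1 = K"
    and b_eq: "Comp E p b0 = Comp E b t" "Comp E b0 m = Comp E i b1"
    by (rule lift_to_syzygies[OF MT T KP 1(10-12)])
  \<comment> \<open>The error \<open>h = d e\<close> is lifted through its projective
    \<open>S\<close>. The lifted term \<open>d0 e p\<close> vanishes on \<open>K\<close> since
    \<open>p i = 0\<close>.\<close>
  obtain d0 where d: "d0 \<in> Ar E" "Dom E d0 = S" "Cod E d0 = P" "Comp E p d0 = d"
    using Proj_lift[OF 2(1) i(11,4) 2(3,6)] 2(7) i(5,6) by auto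
  let ?g = "Add E (Comp E v0 u0) (Add E (Comp E b0 a0) (Comp E d0 (Comp E e p)))"
  note arrs = 1(1-12) 2(2-7) i(1-9) j(1-9) m(1-9) u v a b d(1-3)
  note reassoc = comp_reassoc[OF v_eq(1)] comp_reassoc[OF b_eq(1)] comp_reassoc[OF d(4)]
    comp_reassoc[OF v_eq(2)] comp_reassoc[OF b_eq(2)]
  have g: "?g \<in> Ar E" "Dom E ?g = P" "Cod E ?g = P"
    using arrs by (simp_all add: arr_simps)
  have "Comp E p ?g = Comp E (Add E (Comp E v u) (Add E (Comp E b a) (Comp E d e))) p"
    using arrs by (simp add: arr_simps reassoc u_eq a_eq)
  also have "\<dots> = Comp E p (Id E P)"
    using id unfolding 2(8) using i(1-9) by (simp add: arr_simps)
  finally have "Comp E p (Id E P) = Comp E p ?g" ..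
  with g obtain s where s: "s \<in> Ar E" "Dom E s = P" "Cod E s = K" "Id E P = Add E ?g (Comp E i s)"
    by (rule kernel_difference[OF KP arr_Id[OF i(8)]])
  have "Comp E i (Id E K) = Comp E (Id E P) i"
    using i(1-9) by (simp add: arr_simps)
  also have "\<dots> = Comp E (Add E ?g (Comp E i s)) i" unfolding s(4) ..
  also have "\<dots> = Comp E i (Add E (Comp E v1 u1) (Add E (Comp E b1 a1) (Comp E s i)))"
    using arrs s(1-3) by (simp add: arr_simps reassoc u_eq a_eq i(10))
  finally have eq: "Comp E i (Id E K) = Comp E i (Add E (Comp E v1 u1) (Add E (Comp E b1 a1) (Comp E s i)))" .
  have "Id E K = Add E (Comp E v1 u1) (Add E (Comp E b1 a1) (Comp E s i))"
    by (rule kernel_mono[OF KP _ _ _ _ _ eq])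
      (use u v a b i(1-9) s(1-3) in \<open>simp_all add: arr_simps\<close>)
  moreover have "factors_through_proj E (Comp E s i)"
    using factors_through_projI[OF P] i(1-9) s(1-3) by simp
  ultimately show ?thesis
    using u v a b i(1-9) s(1-3)
    by (intro stable_retract_of_sumI[of u1 K L v1 a1 M b1 "Comp E s i"]) (simp_all add: arr_simps)
qed

text \<open>A section \<open>s\<close> of \<open>p\<close> exists, and \<open>1 - s p\<close> maps
  into the kernel. This gives a retraction of \<open>i\<close>, so \<open>K\<close> is a retract of
  \<open>P\<close>.\<close>

lemma kernel_of_Proj:
  assumes KP: "conflation E K i P p X" and P: "P \<in> Proj E" and X: "X \<in> Proj E"
  shows "K \<in> Proj E"
proof -
  note i = conflationD[OF KP]
  obtain s where s: "s \<in> Ar E" "Dom E s = X" "Cod E s = P" "Comp E p s = Id E X"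
    using Proj_lift[OF X i(11,4), of "Id E X"] i(1-9) by (auto simp: arr_simps)
  have "Comp E p (Id E P) = Comp E p (Comp E s p)"
    using comp_reassoc[OF s(4)] s(1-3) i(1-9) by (simp add: arr_simps)
  moreover have "Comp E s p \<in> Ar E" "Dom E (Comp E s p) = P" "Cod E (Comp E s p) = P"
    using i(1-9) s(1-3) by (simp_all add: arr_Comp)
  ultimately obtain t where t: "t \<in> Ar E" "Dom E t = P" "Cod E t = K" "Id E P = Add E (Comp E s p) (Comp E i t)"
    using kernel_difference[OF KP arr_Id[OF i(8)]] by blast
  have "Comp E i (Id E K) = Comp E (Id E P) i"
    using i(1-9) by (simp add: arr_simps)
  also have "\<dots> = Comp E (Add E (Comp E s p) (Comp E i t)) i" unfolding t(4) ..
  also have "\<dots> = Comp E i (Comp E t i)"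
    using s(1-3) t(1-3) i by (simp add: arr_simps)
  finally have eq: "Comp E i (Id E K) = Comp E i (Comp E t i)" .
  have "Id E K = Comp E t i"
    by (rule kernel_mono[OF KP _ _ _ _ _ eq])
      (use t(1-3) i(1-9) in \<open>simp_all add: arr_simps\<close>)
  then have "stable_retract E K P"
    using i t by (intro retract_imp_stable_retract[of i K P t]) simp_all
  then show ?thesis using P by (rule stable_retract_Proj)
qed

text \<open>The universal property is split into existence of \<open>w\<close> and joint monicity of
  \<open>r\<close> and \<open>q'\<close>: one builds morphisms into the pullback, the other compares
  them.\<close>

lemma deflation_pullbackE:
  assumes q: "q \<in> Ar E" "Cod E q = B" "deflation E q" and p: "p \<in> Ar E" "Dom E p = Q" "Cod E p = B"
  obtains L l W q' r where "conflation E L l W q' Q" "r \<in> Ar E" "Dom E r = W" "Cod E r = Dom E q"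
    "Comp E q r = Comp E p q'"
    "\<forall>g h. g \<in> Ar E \<longrightarrow> h \<in> Ar E \<longrightarrow> Dom E g = Dom E h \<longrightarrow> Cod E g = Dom E q \<longrightarrow> Cod E h = Q \<longrightarrow>
      Comp E q g = Comp E p h \<longrightarrow>
      (\<exists>w. w \<in> Ar E \<and> Dom E w = Dom E h \<and> Cod E w = W \<and> Comp E r w = g \<and> Comp E q' w = h)"
    "\<forall>w w'. w \<in> Ar E \<longrightarrow> w' \<in> Ar E \<longrightarrow> Dom E w = Dom E w' \<longrightarrow> Cod E w = W \<longrightarrow> Cod E w' = W \<longrightarrow>
      Comp E r w = Comp E r w' \<longrightarrow> Comp E q' w = Comp E q' w' \<longrightarrow> w = w'"
proof -
  obtain q' r where pb: "is_pullback E q p q' r" and q': "deflation E q'"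
    using deflation_pullback[of q "Dom E q" B p Q] q p by (auto simp: Hom_def)
  from pb obtain A R A' W where
    "q \<in> Hom E R A" "p \<in> Hom E A' A" and W: "q' \<in> Hom E W A'" "r \<in> Hom E W R"
    and eq: "Comp E q r = Comp E p q'" and
    univ: "\<And>T g h. T \<in> Ob E \<Longrightarrow> g \<in> Hom E T R \<Longrightarrow> h \<in> Hom E T A' \<Longrightarrow> Comp E q g = Comp E p h \<Longrightarrow>
           (\<exists>!w. w \<in> Hom E T W \<and> Comp E r w = g \<and> Comp E q' w = h)"
    unfolding is_pullback_def by blast
  then have [simp]: "R = Dom E q" "A' = Q" using p by (auto simp: Hom_def)
  have W': "q' \<in> Ar E" "Dom E q' = W" "Cod E q' = Q" "r \<in> Ar E" "Dom E r = W" "Cod E r = Dom E q"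
    using W by (auto simp: Hom_def)
  obtain l where l: "(l, q') \<in> Conf E" using q' by (auto simp: deflation_def)
  have "l \<in> Hom E (Dom E l) W"
    using Conf_kernel[OF l] W' by (auto simp: is_kernel_def Hom_def)
  then have 1: "conflation E (Dom E l) l W q' Q"
    using l W by (simp add: conflation_def)
  have 2: "\<exists>w. w \<in> Ar E \<and> Dom E w = Dom E h \<and> Cod E w = W \<and> Comp E r w = g \<and> Comp E q' w = h"
    if "g \<in> Ar E" "h \<in> Ar E" "Dom E g = Dom E h" "Cod E g = Dom E q" "Cod E h = Q"
      "Comp E q g = Comp E p h" for g h
  proof -
    have "g \<in> Hom E (Dom E h) R" "h \<in> Hom E (Dom E h) A'" using that by (simp_all add: Hom_def)
    from univ[OF Dom_in[OF that(2)] this that(6)]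
    obtain w where "w \<in> Hom E (Dom E h) W" "Comp E r w = g" "Comp E q' w = h" by blast
    then show ?thesis by (intro exI[of _ w]) (simp add: Hom_def)
  qed
  have 3: "w = w'"
    if w: "w \<in> Ar E" "w' \<in> Ar E" "Dom E w = Dom E w'" "Cod E w = W" "Cod E w' = W"
      "Comp E r w = Comp E r w'" "Comp E q' w = Comp E q' w'" for w w'
  proof -
    have h: "Comp E r w' \<in> Hom E (Dom E w') R" "Comp E q' w' \<in> Hom E (Dom E w') A'"
      using W' w(1-5) by (simp_all add: Hom_def arr_Comp)
    have "Comp E q (Comp E r w') = Comp E p (Comp E q' w')"
      using comp_reassoc[OF eq] arr_assoc[of w' q' p] W' w(1-5) q p by simp
    from univ[OF Dom_in[OF w(2)] h this] show ?thesis
      using w by (auto simp: Hom_def)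
  qed
  show ?thesis
    using 2 3 by (intro that[OF 1 W'(4-6) eq] allI impI) blast+
qed

end

section \<open>Stable agreement and rotation of conflations\<close>

definition mutual_stable_retracts :: "('o, 'm, 'z) exact_cat_scheme \<Rightarrow> 'o \<Rightarrow> 'o \<Rightarrow> bool" where
  "mutual_stable_retracts E X Y \<longleftrightarrow> stable_retract E X Y \<and> stable_retract E Y X"

context exact_category
begin

lemma mutual_stable_retracts_sym: "mutual_stable_retracts E X Y \<Longrightarrow> mutual_stable_retracts E Y X"
  by (simp add: mutual_stable_retracts_def)

lemma mutual_stable_retracts_trans:
  "mutual_stable_retracts E X Y \<Longrightarrow> mutual_stable_retracts E Y Z \<Longrightarrow> mutual_stable_retracts E X Z"
  unfolding mutual_stable_retracts_def by (blast intro: stable_retract_trans)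

lemma mutual_stable_retracts_refl: "X \<in> Ob E \<Longrightarrow> mutual_stable_retracts E X X"
  by (simp add: mutual_stable_retracts_def stable_retract_refl)

text \<open>
  The rotation comes from the pullback of \<open>R \<rightarrow> B\<close> along \<open>Q \<rightarrow> B\<close>: its other projection splits
  because \<open>R\<close> is projective, so the pullback is stably \<open>A\<close>.
\<close>

lemma rotate_conflation:
  assumes AQ: "conflation E A i Q p B" and LR: "conflation E L j R q B" and R: "R \<in> Proj E"
  obtains L' l W w where "conflation E L' l W w Q"
    "mutual_stable_retracts E L' L" "mutual_stable_retracts E W A"
proof -
  note i = conflationD[OF AQ] and j = conflationD[OF LR]
  obtain L' l W q' r where LW: "conflation E L' l W q' Q"
    and r: "r \<in> Ar E" "Dom E r = W" "Cod E r = Dom E q" and sq: "Comp E q r = Comp E p q'"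
    and pair: "\<forall>g h. g \<in> Ar E \<longrightarrow> h \<in> Ar E \<longrightarrow> Dom E g = Dom E h \<longrightarrow> Cod E g = Dom E q \<longrightarrow>
      Cod E h = Q \<longrightarrow> Comp E q g = Comp E p h \<longrightarrow>
      (\<exists>w. w \<in> Ar E \<and> Dom E w = Dom E h \<and> Cod E w = W \<and> Comp E r w = g \<and> Comp E q' w = h)"
    and joint_mono: "\<forall>w w'. w \<in> Ar E \<longrightarrow> w' \<in> Ar E \<longrightarrow> Dom E w = Dom E w' \<longrightarrow> Cod E w = W \<longrightarrow>
      Cod E w' = W \<longrightarrow> Comp E r w = Comp E r w' \<longrightarrow> Comp E q' w = Comp E q' w' \<longrightarrow> w = w'"
    by (rule deflation_pullbackE[OF j(4,6,11) i(4,5,6)])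
  note pair = pair[rule_format] and joint_mono = joint_mono[rule_format]
  note l = conflationD[OF LW]
  note arrs = i(1-9) j(1-9) l(1-9) r
  have "mutual_stable_retracts E L' L"
  proof -
    \<comment> \<open>\<open>z\<close> is the pair \<open>(j, 0)\<close>. Since
      \<open>q' z = 0\<close>, it factors through the kernel \<open>l\<close> of
      \<open>q'\<close>.\<close>
    obtain z where z: "z \<in> Ar E" "Dom E z = L" "Cod E z = W" "Comp E r z = j" "Comp E q' z = Zer E L Q"
      using pair[of j "Zer E L Q"] arrs j(10) by (auto simp: arr_simps)
    obtain g where g: "g \<in> Ar E" "Dom E g = L" "Cod E g = L'" "Comp E l g = z"
      using kernel_factorE[OF LW z(1,3)] z(2,5) by auto
    have "Comp E q (Comp E r l) = Comp E p (Comp E q' l)"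
      using arrs by (simp add: comp_reassoc[OF sq] arr_assoc)
    also have "\<dots> = Zer E L' B"
      unfolding l(10) using arrs by (simp add: arr_simps)
    finally obtain h where h: "h \<in> Ar E" "Dom E h = L'" "Cod E h = L" "Comp E j h = Comp E r l"
      using kernel_factorE[OF LR, of "Comp E r l"] arrs by (auto simp: arr_simps)
    have jhg: "Comp E j (Comp E h g) = Comp E j (Id E L)"
      using arrs g h(1-3) z(4) comp_reassoc[OF h(4), of g] by (simp add: arr_simps)
    have hg: "Comp E h g = Id E L"
      by (rule kernel_mono[OF LR _ _ _ _ _ jhg]) (use arrs g(1-3) h(1-3) in \<open>simp_all add: arr_simps\<close>)
    have "Comp E z h = l"
    proof (rule joint_mono)
      show "Comp E r (Comp E z h) = Comp E r l"
        using comp_reassoc[OF z(4), of h] arrs z(1-3) h by simp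
      show "Comp E q' (Comp E z h) = Comp E q' l"
        using comp_reassoc[OF z(5), of h] arrs z(1-3) h(1-3) l(10) by (simp add: arr_simps)
    qed (use arrs z(1-3) h(1-3) in \<open>simp_all add: arr_simps\<close>)
    then have lgh: "Comp E l (Comp E g h) = Comp E l (Id E L')"
      using comp_reassoc[OF g(4), of h] arrs g(1-3) h(1-3) by (simp add: arr_simps)
    have gh: "Comp E g h = Id E L'"
      by (rule kernel_mono[OF LW _ _ _ _ _ lgh]) (use arrs g(1-3) h(1-3) in \<open>simp_all add: arr_simps\<close>)
    show ?thesis
      unfolding mutual_stable_retracts_def
      using retract_imp_stable_retract[OF g(1-3) h(1-3) hg] retract_imp_stable_retract[OF h(1-3) g(1-3) gh]
      by simp
  qed
  moreover have "mutual_stable_retracts E W A"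
  proof -
    \<comment> \<open>Lifting \<open>q\<close> through \<open>p\<close> gives \<open>s\<close>. Then
      \<open>d = (1, s)\<close> is a section of \<open>r\<close>, and \<open>a = (0, i)\<close> maps
      \<open>A\<close> into the pullback.\<close>
    obtain s where s: "s \<in> Ar E" "Dom E s = R" "Cod E s = Q" "Comp E p s = q"
      using Proj_lift[OF R i(11,4) j(4,5)] i(5,6) j(6) by auto
    obtain d where d: "d \<in> Ar E" "Dom E d = R" "Cod E d = W" "Comp E r d = Id E R" "Comp E q' d = s"
      using pair[of "Id E R" s] arrs s by (auto simp: arr_simps)
    obtain a where a: "a \<in> Ar E" "Dom E a = A" "Cod E a = W" "Comp E r a = Zer E A R" "Comp E q' a = i"
      using pair[of "Zer E A R" i] arrs i(10) by (auto simp: arr_simps)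
    have sr: "Comp E s r \<in> Ar E" "Dom E (Comp E s r) = W" "Cod E (Comp E s r) = Q"
      using arrs s(1-3) by (simp_all add: arr_Comp)
    \<comment> \<open>\<open>q'\<close> and \<open>s r\<close> agree after \<open>p\<close>, so
      their difference is \<open>i b\<close>; this \<open>b\<close> is the retraction of
      \<open>W\<close> onto \<open>A\<close>.\<close>
    have "Comp E p q' = Comp E p (Comp E s r)"
      using arrs s(1-3) comp_reassoc[OF s(4), of r] sq by simp
    then obtain b where b: "b \<in> Ar E" "Dom E b = W" "Cod E b = A" and
      q': "q' = Add E (Comp E s r) (Comp E i b)"
      by (rule kernel_difference[OF AQ l(4,5,6) sr])
    \<comment> \<open>The identity splits into a part through \<open>R\<close> and a part through
      \<open>A\<close>; the former lies in the ideal, so stably only \<open>A\<close>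
      remains.\<close>
    have "Id E W = Add E (Comp E d r) (Comp E a b)"
    proof (rule joint_mono)
      have "Comp E r (Add E (Comp E d r) (Comp E a b)) = r"
        using arrs a(1-4) b d(1-4) comp_reassoc[OF d(4), of r] comp_reassoc[OF a(4), of b]
        by (simp add: arr_simps)
      then show "Comp E r (Id E W) = Comp E r (Add E (Comp E d r) (Comp E a b))"
        using arrs by (simp add: arr_simps)
      have "Comp E q' (Add E (Comp E d r) (Comp E a b)) = Add E (Comp E s r) (Comp E i b)"
        using arrs a(1-3) b d(1-3) comp_reassoc[OF d(5), of r] comp_reassoc[OF a(5), of b]
        by (simp add: arr_simps)
      then show "Comp E q' (Id E W) = Comp E q' (Add E (Comp E d r) (Comp E a b))"
        unfolding q'[symmetric] using arrs by (simp add: arr_simps)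
    qed (use arrs a(1-3) b d(1-3) in \<open>simp_all add: arr_simps\<close>)
    also have "\<dots> = Add E (Comp E a b) (Comp E d r)"
      using arrs a(1-3) b d(1-3) by (intro Add_commute) (simp_all add: arr_Comp)
    finally have WA: "stable_retract E W A"
      using arrs a(1-3) b d(1-3) factors_through_projI[OF R, of r d]
      by (intro stable_retractI[of b W A a "Comp E d r"]) (simp_all add: arr_Comp)
    have "Comp E q' a = Comp E (Add E (Comp E s r) (Comp E i b)) a"
      using q' by simp
    also have "\<dots> = Comp E i (Comp E b a)"
      using arrs s(1-3) a(1-4) b by (simp add: arr_simps)
    finally have iba: "Comp E i (Comp E b a) = Comp E i (Id E A)"
      using a(5) arrs by (simp add: arr_simps)
    have ba: "Comp E b a = Id E A"
      by (rule kernel_mono[OF AQ _ _ _ _ _ iba]) (use arrs a(1-3) b in \<open>simp_all add: arr_simps\<close>)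
    show ?thesis
      unfolding mutual_stable_retracts_def
      using WA retract_imp_stable_retract[OF a(1-3) b ba] by simp
  qed
  ultimately show ?thesis using that[OF LW] by blast
qed

end

text \<open>Well-ordering of \<open>enat\<close> turns a nonempty infimum into a minimum, from which
  a witness for the level is extracted.\<close>

lemma enat_Inf_attained:
  fixes A :: "enat set"
  assumes "A \<noteq> {}"
  shows "Inf A \<in> A"
  using assms unfolding Inf_enat_def by (auto intro: LeastI)

section \<open>Syzygies\<close>

locale exact_category_enough = exact_category E for E :: "('o, 'm, 'z) exact_cat_scheme" +
  assumes enough: "enough_projectives E"
begin

inductive_cases is_syzygy_0E: "is_syzygy E 0 M N"
inductive_cases is_syzygy_SucE: "is_syzygy E (Suc n) M N"

lemma is_syzygy_Ob: "is_syzygy E n M N \<Longrightarrow> M \<in> Ob E \<and> N \<in> Ob E"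
  by (induction rule: is_syzygy.induct) (auto dest: conflationD(9))

lemma is_syzygy_ex: "M \<in> Ob E \<Longrightarrow> \<exists>N. is_syzygy E n M N"
proof (induction n arbitrary: M)
  case 0
  then show ?case by (blast intro: is_syzygy.zero)
next
  case (Suc n)
  then obtain K P i p where KP: "P \<in> Proj E" "conflation E K i P p M"
    using enough unfolding enough_projectives_def by blast
  then obtain N where "is_syzygy E n K N"
    using Suc.IH[OF conflationD(7)] by blast
  with KP show ?case by (blast intro: is_syzygy.step)
qed

lemma is_syzygy_Proj: "is_syzygy E n M N \<Longrightarrow> M \<in> Proj E \<Longrightarrow> N \<in> Proj E"
  by (induction rule: is_syzygy.induct) (auto dest: kernel_of_Proj)

lemma stable_retract_of_sum_syzygies:
  assumes "stable_retract_of_sum E X Y R"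
    and "is_syzygy E n X X'" "is_syzygy E n Y Y'" "is_syzygy E n R R'"
  shows "stable_retract_of_sum E X' Y' R'"
  using assms
proof (induction n arbitrary: X Y R)
  case 0
  then show ?case by (auto elim!: is_syzygy_0E)
next
  case (Suc n)
  obtain P K i p where 1: "P \<in> Proj E" "conflation E K i P p X" "is_syzygy E n K X'"
    by (rule is_syzygy_SucE[OF Suc.prems(2)])
  obtain Q L j q where 2: "Q \<in> Proj E" "conflation E L j Q q Y" "is_syzygy E n L Y'"
    by (rule is_syzygy_SucE[OF Suc.prems(3)])
  obtain T M m t where 3: "T \<in> Proj E" "conflation E M m T t R" "is_syzygy E n M R'"
    by (rule is_syzygy_SucE[OF Suc.prems(4)])
  show ?case
    by (rule Suc.IH[OF stable_retract_of_sum_kernels[OF Suc.prems(1) 1(2,1) 2(2,1) 3(2,1)] 1(3) 2(3) 3(3)])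
qed

text \<open>The error is recorded as a projective summand \<open>R\<close>, all three objects are
  followed through \<open>n\<close> steps, and the syzygy of \<open>R\<close>, still projective, is
  absorbed again.\<close>

lemma stable_retract_syzygies:
  assumes XY: "stable_retract E X Y" and X: "is_syzygy E n X X'" and Y: "is_syzygy E n Y Y'"
  shows "stable_retract E X' Y'"
proof -
  obtain R where R: "R \<in> Proj E" "stable_retract_of_sum E X Y R"
    using stable_retract_imp_sum[OF XY] .
  obtain R' where R': "is_syzygy E n R R'"
    using is_syzygy_ex[OF Proj_Ob[OF R(1)]] by blast
  show ?thesis
    by (rule stable_retract_of_sum_Proj[OF stable_retract_of_sum_syzygies[OF R(2) X Y R']
          is_syzygy_Proj[OF R' R(1)]])
qed

lemma mutual_stable_retracts_syzygies:
  assumes "mutual_stable_retracts E X Y" "is_syzygy E n X X'" "is_syzygy E n Y Y'"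
  shows "mutual_stable_retracts E X' Y'"
  using assms stable_retract_syzygies unfolding mutual_stable_retracts_def by blast

text \<open>A weak form of Schanuel's lemma: reflexivity pushed through two resolutions of one
  object.\<close>

lemma is_syzygy_unique:
  assumes "is_syzygy E n X A" "is_syzygy E n X B"
  shows "mutual_stable_retracts E A B"
  using mutual_stable_retracts_syzygies[OF mutual_stable_retracts_refl assms] is_syzygy_Ob[OF assms(1)]
  by blast

text \<open>Continuing a resolution beyond a projective syzygy gives only projectives, so a
  dimension bound can be used at any larger level.\<close>

lemma is_syzygy_Proj_mono:
  assumes "is_syzygy E m M N" "N \<in> Proj E" "m \<le> n"
  shows "\<exists>N'\<in>Proj E. is_syzygy E n M N'"
proof -
  have "is_syzygy E m M N \<Longrightarrow> is_syzygy E d N N' \<Longrightarrow> is_syzygy E (m + d) M N'" for d N'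
    by (induction rule: is_syzygy.induct) (auto intro: is_syzygy.step)
  moreover obtain N' where N': "is_syzygy E (n - m) N N'"
    using is_syzygy_ex is_syzygy_Ob[OF assms(1)] by blast
  ultimately have "is_syzygy E n M N'"
    using assms(1,3) by fastforce
  then show ?thesis using is_syzygy_Proj[OF N' assms(2)] by blast
qed

text \<open>
  Three rotations replace \<open>0 \<rightarrow> A \<rightarrow> Q \<rightarrow> B \<rightarrow> 0\<close> by a conflation that is stably
  \<open>0 \<rightarrow> \<Omega> A \<rightarrow> \<Omega> Q \<rightarrow> \<Omega> B \<rightarrow> 0\<close>, lowering the projective dimension of the middle term;
  this avoids the horseshoe lemma.
\<close>

lemma syzygy_dimension_shift:
  assumes "conflation E A i Q p B" and "is_syzygy E n Q N" "N \<in> Proj E"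
    and "is_syzygy E n A A'" and "is_syzygy E (Suc n) B B'"
  shows "mutual_stable_retracts E A' B'"
  using assms
proof (induction n arbitrary: A i Q p B N A' B')
  case 0
  \<comment> \<open>A zeroth syzygy is the object itself, so \<open>Q\<close> is projective and
    \<open>A\<close> is a first syzygy of \<open>B\<close>.\<close>
  have Q: "Q \<in> Proj E" and A: "A' = A"
    using 0 by (auto elim!: is_syzygy_0E)
  have "is_syzygy E (Suc 0) B A"
    using is_syzygy.step[OF Q 0(1) is_syzygy.zero] conflationD(7)[OF 0(1)] by blast
  then show ?case unfolding A by (rule is_syzygy_unique[OF _ 0(5)])
next
  case (Suc n)
  obtain PQ Q1 i2 p2 where Q: "PQ \<in> Proj E" "conflation E Q1 i2 PQ p2 Q" "is_syzygy E n Q1 N"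
    by (rule is_syzygy_SucE[OF Suc.prems(2)])
  obtain PA A1 i1 p1 where A: "PA \<in> Proj E" "conflation E A1 i1 PA p1 A" "is_syzygy E n A1 A'"
    by (rule is_syzygy_SucE[OF Suc.prems(4)])
  obtain PB B1 i3 p3 where B: "PB \<in> Proj E" "conflation E B1 i3 PB p3 B" "is_syzygy E (Suc n) B1 B'"
    by (rule is_syzygy_SucE[OF Suc.prems(5)])
  \<comment> \<open>Stably \<Omega> B \<rightarrow> A \<rightarrow> Q.\<close>
  obtain L1 l1 E1 e1 where 1: "conflation E L1 l1 E1 e1 Q"
    "mutual_stable_retracts E L1 B1" "mutual_stable_retracts E E1 A"
    by (rule rotate_conflation[OF Suc.prems(1) B(2,1)])
  \<comment> \<open>Stably \<Omega> Q \<rightarrow> \<Omega> B \<rightarrow> A.\<close>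
  obtain L2 l2 E2 e2 where 2: "conflation E L2 l2 E2 e2 E1"
    "mutual_stable_retracts E L2 Q1" "mutual_stable_retracts E E2 L1"
    by (rule rotate_conflation[OF 1(1) Q(2,1)])
  \<comment> \<open>\<open>E1\<close> agrees with \<open>A\<close> only stably, so it gets its own
    projective deflation; the kernel \<open>K\<close> is compared with \<open>A1\<close>
    below.\<close>
  obtain K P k k' where K: "P \<in> Proj E" "conflation E K k P k' E1"
    using enough conflationD(8)[OF 1(1)] unfolding enough_projectives_def by blast
  \<comment> \<open>Stably \<Omega> A \<rightarrow> \<Omega> Q \<rightarrow> \<Omega> B, ready for
    the induction hypothesis.\<close>
  obtain L3 l3 E3 e3 where 3: "conflation E L3 l3 E3 e3 E2"
    "mutual_stable_retracts E L3 K" "mutual_stable_retracts E E3 L2"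
    by (rule rotate_conflation[OF 2(1) K(2,1)])
  have syz1: "is_syzygy E (Suc 0) E1 K" "is_syzygy E (Suc 0) A A1"
    using K A(1,2) conflationD(7) by (blast intro: is_syzygy.intros)+
  have L3: "mutual_stable_retracts E L3 A1"
    by (rule mutual_stable_retracts_trans[OF 3(2) mutual_stable_retracts_syzygies[OF 1(3) syz1]])
  have E3: "mutual_stable_retracts E E3 Q1"
    by (rule mutual_stable_retracts_trans[OF 3(3) 2(2)])
  have E2: "mutual_stable_retracts E E2 B1"
    by (rule mutual_stable_retracts_trans[OF 2(3) 1(2)])
  obtain A3 N3 B3 where syz: "is_syzygy E n L3 A3" "is_syzygy E n E3 N3" "is_syzygy E (Suc n) E2 B3"
    using is_syzygy_ex conflationD(7-9)[OF 3(1)] by metis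
  \<comment> \<open>A retract of the projective \<open>N\<close> is projective; this transfers the
    dimension bound from \<open>Q1\<close> to \<open>E3\<close>.\<close>
  have "stable_retract E N3 N"
    using mutual_stable_retracts_syzygies[OF E3 syz(2) Q(3)] by (simp add: mutual_stable_retracts_def)
  then have "N3 \<in> Proj E" using Suc.prems(3) by (rule stable_retract_Proj)
  then have "mutual_stable_retracts E A3 B3"
    by (rule Suc.IH[OF 3(1) syz(2) _ syz(1,3)])
  moreover have "mutual_stable_retracts E A' A3"
    using mutual_stable_retracts_syzygies[OF L3 syz(1) A(3)] by (rule mutual_stable_retracts_sym)
  moreover have "mutual_stable_retracts E B3 B'"
    by (rule mutual_stable_retracts_syzygies[OF E2 syz(3) B(3)])
  ultimately show ?case by (blast intro: mutual_stable_retracts_trans)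
qed

lemma is_syzygy_Omega:
  assumes "syzygy_choice E S" "X \<in> Ob E"
  shows "is_syzygy E n X ((Omega E S ^^ n) X)"
  using assms(2)
proof (induction n arbitrary: X)
  case 0
  then show ?case by (simp add: is_syzygy.zero)
next
  case (Suc n)
  obtain K P where P: "P \<in> Proj E" and c: "conflation E K (fst (S X)) P (snd (S X)) X"
    using assms(1) Suc.prems unfolding syzygy_choice_def by blast
  have "Omega E S X = K" using conflationD(2)[OF c] by (simp add: Omega_def)
  \<comment> \<open>\<open>is_syzygy\<close> takes the step at \<open>X\<close> first, so the
    iterate is unfolded at its innermost application.\<close>
  then show ?case
    using is_syzygy.step[OF P c Suc.IH[OF conflationD(7)[OF c]]] by (simp add: funpow_Suc_right del: funpow.simps)
qed

end

section \<open>Exact functors\<close>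

locale exact_functor_enough = exact_functor E E' F + source: exact_category_enough E +
  target: exact_category_enough E'
  for E :: "('o, 'm, 'z) exact_cat_scheme" and E' :: "('p, 'n, 'w) exact_cat_scheme"
    and F :: "('o, 'm, 'p, 'n, 'u) ftor_scheme"
begin

lemma FAr_conflation:
  assumes "conflation E X i Y p Z"
  shows "conflation E' (FOb F X) (FAr F i) (FOb F Y) (FAr F p) (FOb F Z)"
  using assms FAr_in FAr_Conf unfolding conflation_def by blast

lemma FAr_is_iso:
  assumes "is_iso E X Y f"
  shows "is_iso E' (FOb F X) (FOb F Y) (FAr F f)"
proof -
  obtain g where f: "f \<in> Hom E X Y" and g: "g \<in> Hom E Y X"
    and gf: "Comp E g f = Id E X" and fg: "Comp E f g = Id E Y"
    using assms unfolding is_iso_def by blast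
  have "X \<in> Ob E" "Y \<in> Ob E" using HomD[OF f] source.Dom_in source.Cod_in by auto
  then have "Comp E' (FAr F g) (FAr F f) = Id E' (FOb F X)" "Comp E' (FAr F f) (FAr F g) = Id E' (FOb F Y)"
    using FAr_Comp[OF f g] FAr_Comp[OF g f] gf fg by (simp_all add: FAr_Id)
  then show ?thesis
    unfolding is_iso_def using FAr_in[OF f] FAr_in[OF g] by blast
qed

lemma FAr_adm_exact:
  assumes "adm_exact E t C d X"
  shows "adm_exact E' t (\<lambda>i. FOb F (C i)) (\<lambda>i. FAr F (d i)) (FOb F X)"
proof (cases "t = 0")
  case True
  then show ?thesis using assms FAr_is_iso by (simp add: adm_exact_def)
next
  case False
  then obtain Z a b where Z: "Z 0 = X" "Z t = C t" "d 0 = b 0" "d t = a (t - 1)"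
    and conf: "\<And>i. i < t \<Longrightarrow> conflation E (Z (Suc i)) (a i) (C i) (b i) (Z i)"
    and d: "\<And>i. 0 < i \<Longrightarrow> i < t \<Longrightarrow> d i = Comp E (a (i - 1)) (b i)"
    using assms unfolding adm_exact_def by auto
  have "FAr F (d i) = Comp E' (FAr F (a (i - 1))) (FAr F (b i))" if "0 < i" "i < t" for i
  proof -
    have "b i \<in> Hom E (C i) (Z i)" "a (i - 1) \<in> Hom E (Z i) (C (i - 1))"
      using conf[of i] conf[of "i - 1"] that by (auto simp: conflation_def)
    then show ?thesis using d[OF that] FAr_Comp by simp
  qed
  then have "\<exists>Z' a' b'. Z' 0 = FOb F X \<and> Z' t = FOb F (C t) \<and>
      (\<forall>i<t. conflation E' (Z' (Suc i)) (a' i) (FOb F (C i)) (b' i) (Z' i)) \<and> FAr F (d 0) = b' 0 \<and>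
      (\<forall>i. 0 < i \<and> i < t \<longrightarrow> FAr F (d i) = Comp E' (a' (i - 1)) (b' i)) \<and> FAr F (d t) = a' (t - 1)"
    using Z FAr_conflation[OF conf]
    by (intro exI[of _ "\<lambda>i. FOb F (Z i)"] exI[of _ "\<lambda>i. FAr F (a i)"] exI[of _ "\<lambda>i. FAr F (b i)"]) simp
  then show ?thesis unfolding adm_exact_def using False by simp
qed

text \<open>An error through a projective \<open>R\<close> becomes one through \<open>F R\<close>,
  which need not be projective and is therefore kept as a summand.\<close>

lemma FAr_stable_retract:
  assumes XY: "stable_retract E X Y"
  obtains R where "R \<in> Proj E" "stable_retract_of_sum E' (FOb F X) (FOb F Y) (FOb F R)"
proof -
  obtain u v h where 1: "u \<in> Hom E X Y" "v \<in> Hom E Y X" "h \<in> Hom E X X"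
    "factors_through_proj E h" "Id E X = Add E (Comp E v u) h"
    using XY unfolding source.stable_retract_iff by blast
  have "Dom E h = X" "Cod E h = X" using HomD[OF 1(3)] by auto
  then obtain R a b where "R \<in> Proj E" "a \<in> Ar E" "b \<in> Ar E" "Dom E a = X" "Cod E a = R"
    "Dom E b = R" "Cod E b = X" and h: "h = Comp E b a"
    by (rule source.factors_through_projE[OF 1(4)])
  then have R: "R \<in> Proj E" and ab: "a \<in> Hom E X R" "b \<in> Hom E R X"
    by (auto simp: Hom_def)
  have X: "X \<in> Ob E" using source.stable_retract_Ob[OF XY] by simp
  \<comment> \<open>The summand \<open>F R\<close> carries the whole error; the remaining error slot
    is zero.\<close>
  let ?Z = "Zer E' (FOb F X) (FOb F X)"
  have "Comp E v u \<in> Hom E X X" "Comp E b a \<in> Hom E X X"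
    using source.Comp_in 1(1,2) ab by blast+
  then have "Id E' (FOb F X) = Add E' (Comp E' (FAr F v) (FAr F u)) (Comp E' (FAr F b) (FAr F a))"
    using FAr_Id[OF X] FAr_Add[of "Comp E v u" X X "Comp E b a"] FAr_Comp[OF 1(1,2)] FAr_Comp[OF ab] 1(5) h
    by simp
  moreover have "Comp E' (FAr F b) (FAr F a) \<in> Hom E' (FOb F X) (FOb F X)"
    using target.Comp_in FAr_in ab by blast
  then have "Add E' (Comp E' (FAr F b) (FAr F a)) ?Z = Comp E' (FAr F b) (FAr F a)"
    using target.Add_Zer by (simp add: Hom_def)
  ultimately have "Add E' (Comp E' (FAr F v) (FAr F u)) (Add E' (Comp E' (FAr F b) (FAr F a)) ?Z)
      = Id E' (FOb F X)" by simp
  moreover have "?Z \<in> Hom E' (FOb F X) (FOb F X)" "factors_through_proj E' ?Z"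
    using target.arr_Zer target.factors_through_proj_Zer FOb_in[OF X] by (auto simp: Hom_def)
  ultimately have "stable_retract_of_sum E' (FOb F X) (FOb F Y) (FOb F R)"
    unfolding stable_retract_of_sum_def using FAr_in 1(1,2) ab by blast
  then show ?thesis using R that by blast
qed

end

text \<open>The bound is encoded as a projective syzygy at exactly the level \<open>c\<close>, for
  all projectives at once, because the dimension shift compares syzygies at a fixed level.\<close>

locale exact_functor_bounded_pd = exact_functor_enough E E' F
  for E :: "('o, 'm, 'z) exact_cat_scheme" and E' :: "('p, 'n, 'w) exact_cat_scheme"
    and F :: "('o, 'm, 'p, 'n, 'u) ftor_scheme" +
  fixes c :: nat
  assumes pd_le: "P \<in> Proj E \<Longrightarrow> \<exists>N\<in>Proj E'. is_syzygy E' c (FOb F P) N"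
begin

text \<open>Each step of the resolution contributes one dimension shift along the image of its
  conflation.\<close>

lemma FOb_syzygy:
  assumes "is_syzygy E n X X'" and "is_syzygy E' c (FOb F X') A" and "is_syzygy E' (c + n) (FOb F X) B"
  shows "mutual_stable_retracts E' A B"
  using assms
proof (induction arbitrary: B rule: is_syzygy.induct)
  case (zero M)
  then show ?case using target.is_syzygy_unique by simp
next
  case (step P K i p M d N)
  have "K \<in> Ob E" using source.conflationD(7)[OF step.hyps(2)] .
  then obtain B1 where B1: "is_syzygy E' (c + d) (FOb F K) B1"
    using target.is_syzygy_ex FOb_in by blast
  obtain N0 where "N0 \<in> Proj E'" "is_syzygy E' c (FOb F P) N0"
    using pd_le[OF step.hyps(1)] by blast
  \<comment> \<open>The shift takes place at level \<open>c + d\<close>, so the projective syzygy of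
    \<open>F P\<close> is moved up from level \<open>c\<close>.\<close>
  then obtain N' where N': "N' \<in> Proj E'" "is_syzygy E' (c + d) (FOb F P) N'"
    using target.is_syzygy_Proj_mono[of c _ _ "c + d"] by auto
  have "mutual_stable_retracts E' B1 B"
    using target.syzygy_dimension_shift[OF FAr_conflation[OF step.hyps(2)] N'(2,1) B1] step.prems(2)
    by simp
  with step.IH[OF step.prems(1) B1] show ?case
    by (rule target.mutual_stable_retracts_trans)
qed

lemma dell_FOb_le:
  assumes S: "syzygy_choice E S" and S': "syzygy_choice E' S'" and X: "X \<in> Ob E"
  shows "dell E' S' k (FOb F X) \<le> enat c + dell E S k X"
proof (cases "\<exists>n. \<exists>Y \<in> Ob E. stable_retract E ((Omega E S ^^ n) X) ((Omega E S ^^ (n + k)) Y)")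
  case False
  \<comment> \<open>The infimum of the empty set is \<infinity>, so the bound is trivial.\<close>
  then have "dell E S k X = Inf {}" unfolding dell_def by (intro arg_cong[of _ _ Inf]) blast
  then show ?thesis by (simp add: Inf_enat_def)
next
  case True
  let ?D = "{enat n | n. \<exists>Y \<in> Ob E. stable_retract E ((Omega E S ^^ n) X) ((Omega E S ^^ (n + k)) Y)}"
  have "Inf ?D \<in> ?D" using True by (intro enat_Inf_attained) blast
  then obtain n Y where n: "dell E S k X = enat n" and Y: "Y \<in> Ob E"
    and ret: "stable_retract E ((Omega E S ^^ n) X) ((Omega E S ^^ (n + k)) Y)"
    unfolding dell_def by blast
  note sX = source.is_syzygy_Omega[OF S X, of n] and sY = source.is_syzygy_Omega[OF S Y, of "n + k"]
  note tX = target.is_syzygy_Omega[OF S' FOb_in[OF X], of "c + n"]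
    and tY = target.is_syzygy_Omega[OF S' FOb_in[OF Y], of "c + (n + k)"]
  obtain R where R: "R \<in> Proj E" and sum: "stable_retract_of_sum E' (FOb F ((Omega E S ^^ n) X))
      (FOb F ((Omega E S ^^ (n + k)) Y)) (FOb F R)"
    using FAr_stable_retract[OF ret] .
  obtain N where N: "N \<in> Proj E'" "is_syzygy E' c (FOb F R) N"
    using pd_le[OF R] by blast
  obtain A where A: "is_syzygy E' c (FOb F ((Omega E S ^^ n) X)) A"
    using target.is_syzygy_ex FOb_in source.is_syzygy_Ob[OF sX] by blast
  obtain B where B: "is_syzygy E' c (FOb F ((Omega E S ^^ (n + k)) Y)) B"
    using target.is_syzygy_ex FOb_in source.is_syzygy_Ob[OF sY] by blast
  \<comment> \<open>At level \<open>c\<close> the syzygy \<open>N\<close> of \<open>F R\<close> is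
    projective, so the extra summand is absorbed.\<close>
  have "stable_retract E' A B"
    by (rule target.stable_retract_of_sum_Proj[OF
          target.stable_retract_of_sum_syzygies[OF sum A B N(2)] N(1)])
  moreover have "stable_retract E' ((Omega E' S' ^^ (c + n)) (FOb F X)) A"
    using FOb_syzygy[OF sX A tX] by (simp add: mutual_stable_retracts_def)
  moreover have "stable_retract E' B ((Omega E' S' ^^ (c + (n + k))) (FOb F Y))"
    using FOb_syzygy[OF sY B tY] by (simp add: mutual_stable_retracts_def)
  ultimately have "stable_retract E' ((Omega E' S' ^^ (c + n)) (FOb F X))
      ((Omega E' S' ^^ (c + n + k)) (FOb F Y))"
    unfolding add.assoc by (blast intro: target.stable_retract_trans)
  then have "dell E' S' k (FOb F X) \<le> enat (c + n)"
    unfolding dell_def using FOb_in[OF Y] by (intro Inf_lower) blast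
  then show ?thesis by (simp add: n)
qed

lemma adm_exact_Ob:
  assumes "adm_exact E t C d X" "i \<le> t"
  shows "C i \<in> Ob E"
proof (cases "t = 0")
  case True
  then have "d 0 \<in> Hom E (C i) X" using assms by (simp add: adm_exact_def is_iso_def)
  then show ?thesis using source.Dom_in[of "d 0"] by (auto simp: Hom_def)
next
  case False
  then obtain Z a b where Z: "Z t = C t"
    and conf: "\<And>i. i < t \<Longrightarrow> conflation E (Z (Suc i)) (a i) (C i) (b i) (Z i)"
    using assms(1) unfolding adm_exact_def by auto
  \<comment> \<open>The last term \<open>C t\<close> is the kernel \<open>Z t\<close>; all others
    are middle terms of conflations.\<close>
  show ?thesis
  proof (cases "i = t")
    case True
    then show ?thesis using source.conflationD(7)[OF conf[of "t - 1"]] False Z by simp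
  next
    case False
    then show ?thesis using source.conflationD(8)[OF conf[of i]] assms(2) by simp
  qed
qed

lemma ddell_FOb_le:
  assumes S: "syzygy_choice E S" and S': "syzygy_choice E' S'"
  shows "ddell E' S' k (FOb F X) \<le> enat c + ddell E S k X"
proof (cases "\<exists>m. \<exists>t\<le>m. \<exists>C d. adm_exact E t C d X \<and> (\<forall>i\<le>t. dell E S (i + k) (C i) \<le> enat (m - i))")
  case False
  then have "ddell E S k X = Inf {}" unfolding ddell_def by (intro arg_cong[of _ _ Inf]) blast
  then show ?thesis by (simp add: Inf_enat_def)
next
  case True
  let ?D = "{enat m | m. \<exists>t \<le> m. \<exists>C d. adm_exact E t C d X \<and>
       (\<forall>i \<le> t. dell E S (i + k) (C i) \<le> enat (m - i))}"
  have "Inf ?D \<in> ?D" using True by (intro enat_Inf_attained) blast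
  then obtain m t C d where m: "ddell E S k X = enat m" and t: "t \<le> m" and ex: "adm_exact E t C d X"
    and le: "\<And>i. i \<le> t \<Longrightarrow> dell E S (i + k) (C i) \<le> enat (m - i)"
    unfolding ddell_def by blast
  \<comment> \<open>The length \<open>t\<close> and the indices \<open>i + k\<close> are kept. As
    \<open>i \<le> t \<le> m\<close>, truncated subtraction satisfies
    \<open>c + (m - i) = c + m - i\<close>.\<close>
  have "dell E' S' (i + k) (FOb F (C i)) \<le> enat (c + m - i)" if "i \<le> t" for i
  proof -
    have "dell E' S' (i + k) (FOb F (C i)) \<le> enat c + dell E S (i + k) (C i)"
      by (rule dell_FOb_le[OF S S' adm_exact_Ob[OF ex that]])
    also have "\<dots> \<le> enat c + enat (m - i)"
      by (intro add_left_mono le that)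
    finally show ?thesis using t that by simp
  qed
  then have "ddell E' S' k (FOb F X) \<le> enat (c + m)"
    unfolding ddell_def using FAr_adm_exact[OF ex] t
    by (intro Inf_lower CollectI exI[of _ "c + m"] conjI refl exI[of _ t]) auto
  then show ?thesis by (simp add: m)
qed

end

text \<open>A finite bound excludes the empty infimum, so the dimension is attained by an actual
  syzygy.\<close>

lemma pd_le_enatD:
  assumes "pd E M \<le> enat c"
  obtains d N where "d \<le> c" "N \<in> Proj E" "is_syzygy E d M N"
proof -
  let ?D = "{enat d | d. \<exists>N\<in>Proj E. is_syzygy E d M N}"
  have "?D \<noteq> {}"
    using assms unfolding pd_def by (auto simp: Inf_enat_def split: if_splits)
  then have "pd E M \<in> ?D"
    unfolding pd_def by (rule enat_Inf_attained)
  then show ?thesis using assms that by auto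
qed

theorem theorem3p13:
  fixes E :: "('o, 'm) exact_cat" and E' :: "('p, 'n) exact_cat"
    and S :: "'o \<Rightarrow> 'm \<times> 'm" and S' :: "'p \<Rightarrow> 'n \<times> 'n"
    and F :: "('o, 'm, 'p, 'n) ftor"
    and c :: enat and X :: 'o and k :: nat
  assumes "exact_category E" and "idempotent_complete E" and "enough_projectives E"
    and "exact_category E'" and "idempotent_complete E'" and "enough_projectives E'"
    and "syzygy_choice E S" and "syzygy_choice E' S'"
    and "exact_functor E E' F"
    and "c = pd_functor E E' F" and "c < \<infinity>"
    and "X \<in> Ob E" and "k \<ge> 1"
  shows "dell E' S' k (FOb F X) \<le> c + dell E S k X
    \<and> ddell E' S' k (FOb F X) \<le> c + ddell E S k X"
proof -
  interpret source: exact_category_enough E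
    using assms(1,3) by (simp add: exact_category_enough_def exact_category_enough_axioms_def)
  interpret target: exact_category_enough E'
    using assms(4,6) by (simp add: exact_category_enough_def exact_category_enough_axioms_def)
  interpret exact_functor E E' F by (rule assms(9))
  obtain c' where c: "c = enat c'" using assms(11) by auto
  \<comment> \<open>The supremum bounds each \<open>F P\<close>; lengthening its resolution places a
    projective syzygy at exactly level \<open>c'\<close>.\<close>
  have "\<exists>N\<in>Proj E'. is_syzygy E' c' (FOb F P) N" if "P \<in> Proj E" for P
  proof -
    have "pd E' (FOb F P) \<le> enat c'"
      using that unfolding c[symmetric] assms(10) pd_functor_def by (intro Sup_upper) blast
    then obtain d N where "d \<le> c'" "N \<in> Proj E'" "is_syzygy E' d (FOb F P) N"
      by (rule pd_le_enatD)
    then show ?thesis using target.is_syzygy_Proj_mono by blast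
  qed
  then interpret exact_functor_bounded_pd E E' F c'
    by unfold_locales
  show ?thesis
    unfolding c using dell_FOb_le[OF assms(7,8,12)] ddell_FOb_le[OF assms(7,8)] by blast
qed

end
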